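(* Consider one time step, from level $k$ to level $k+1$, of the first-order scalar auxiliary-variable scheme described in the context. Assume that $A^k=A(\mathbf u^k,\psi^k)>0$ and that the external data entering the loading potential in $A(\mathbf u,\psi)$ are time-independent; in particular the prescribed displacement $\mathbf u_g$ on $\Gamma_{\delta,u}$ may be nonhomogeneous but is independent of time, and the body force $\mathbf b$ and the prescribed nonlocal traction $\mathbf t$ are also time-independent. Let $(\mathbf u^{k+1},\mathbf v^{k+1},\widetilde\psi^{k+1},r^{k+1})$ be a solution of the scheme (before the irreversibility projection), and define the modified Hamiltonians $$\mathcal H^{k}=\frac\rho2\|\mathbf v^{k}\|^2_{L^2(\Omega\setminus\Gamma_\delta)}+G_c\mathcal A_\delta(\psi^{k},\mathcal L_\delta\psi^{k})+(r^{k})^2-C_0,$$ $$\mathcal H^{k+1}=\frac\rho2\|\mathbf v^{k+1}\|^2_{L^2(\Omega\setminus\Gamma_\delta)}+G_c\mathcal A_\delta(\widetilde\psi^{k+1},\mathcal L_\delta\widetilde\psi^{k+1})+(r^{k+1})^2-C_0 .$$ Then $$\mathcal H^{k+1}-\mathcal H^k+\frac\rho2\|\mathbf v^{k+1}-\mathbf v^k\|^2_{L^2(\Omega\setminus\Gamma_\delta)}+\frac{G_c}2a_\delta(\widetilde\psi^{k+1}-\psi^k,\widetilde\psi^{k+1}-\psi^k)+(r^{k+1}-r^k)^2+\Delta t\,\eta\,\|D_t\widetilde\psi^{k+1}\|^2_{L^2(\Omega)}=0,$$ where $D_t\widetilde\psi^{k+1}=(\widetilde\psi^{k+1}-\psi^k)/\Delta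 t$. Consequently, $\mathcal H^{k+1}\le\mathcal H^k$.
   Context: Geometry. $\Omega\subset\mathbb{R}^d$ ($d=2,3$) is a bounded Lipschitz domain, $\delta>0$, $B_\delta(\mathbf x)$ is the open ball of radius $\delta$ about $\mathbf x$, $\Gamma_\delta=\{\mathbf x\in\Omega:d(\mathbf x,\partial\Omega)\le\delta\}=\Gamma_{\delta,t}\cup\Gamma_{\delta,u}$ with both parts nonempty and with disjoint interiors. Kernel. $\omega_\delta$ is a nonnegative (measurable) radial function on $\mathbb{R}^d$, written $\omega_\delta(|\mathbf x|)$, with $\operatorname{supp}\omega_\delta=\overline{B_\delta(\mathbf 0)}$; $\boldsymbol\omega(\mathbf x,\mathbf y)=(\mathbf y-\mathbf x)\omega_\delta(|\mathbf y-\mathbf x|)$; and $\int_{B_\delta(\mathbf 0)}\mathbf x\otimes\boldsymbol\omega(\mathbf 0,\mathbf x)\,\mathrm dv_{\mathbf x}=\mathbf I_d$. Spaces. $\mathcal V_\omega(\Omega)=\{\mathbf u\in L^2(\Omega;\mathbb{R}^d):\int_\Omega\int_\Omega|\mathbf u(\mathbf y)-\mathbf u(\mathbf x)|^2\omega_\delta(|\mathbf y-\mathbf x|)\,\mathrm dv_{\mathbf y}\mathrm dv_{\mathbf x}<\infty\}$; $\mathcal V_{\omega,\mathbf u_g}(\Omega)$ and $\mathcal V_{\omega,\mathbf 0}(\Omega)$ are its subsets of fields equal to $\mathbf u_g$, respectively $\mathbf 0$, on $\Gamma_{\delta,u}$. $\mathcal M_\omega(\Omega)$ is the space of $\psi\in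 L^2(\Omega)$, extended by zero outside $\Omega$, with $\int_{\mathbb{R}^d}(1+m_\omega(\boldsymbol\xi))|\hat\psi(\boldsymbol\xi)|^2\,\mathrm d\boldsymbol\xi<\infty$, where $\hat\psi$ is the Fourier transform and $m_\omega(\boldsymbol\xi)=\int_{B_\delta(\mathbf 0)}\omega_\delta(|\mathbf y|)(1-\cos(2\pi\boldsymbol\xi\cdot\mathbf y))\,\mathrm dv_{\mathbf y}$. Elastic energy. $\mathcal G_\delta(\mathbf u)(\mathbf x)=\int_{B_\delta(\mathbf x)\cap\Omega}(\mathbf u(\mathbf y)-\mathbf u(\mathbf x))\otimes\boldsymbol\omega(\mathbf x,\mathbf y)\,\mathrm dv_{\mathbf y}$, $\boldsymbol\varepsilon_\delta(\mathbf u)=\frac12(\mathcal G_\delta(\mathbf u)+\mathcal G_\delta(\mathbf u)^\top)$ with eigenvalues $\varepsilon_{\delta,a}$ and orthonormal eigenvectors $\mathbf n_a$. With Lamé constants $\lambda,\mu$ and $\langle x\rangle_\pm=\frac{x\pm|x|}2$: $\mathcal W^\pm_{\delta,e}(\mathbf u)=\frac\lambda2\langle\operatorname{tr}\boldsymbol\varepsilon_\delta\rangle_\pm^2+\mu\sum_a\langle\varepsilon_{\delta,a}\rangle_\pm^2$, $\boldsymbol\sigma^\pm_\delta=\lambda\langle\operatorname{tr}\boldsymbol\varepsilon_\delta\rangle_\pm\mathbf I_d+2\mu\sum_a\langle\varepsilon_{\delta,a}\rangle_\pm\mathbf n_a\otimes\mathbf n_a$. With $g(\psi)=(1-\psi)^2$: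 $\mathcal W_{\delta,de}(\mathbf u,\psi)=g(\psi)\mathcal W^+_{\delta,e}(\mathbf u)+\mathcal W^-_{\delta,e}(\mathbf u)$ and $\boldsymbol\sigma^{\mathrm d}_\delta(\mathbf u,\psi)=g(\psi)\boldsymbol\sigma^+_\delta+\boldsymbol\sigma^-_\delta$. Crack-surface functional and bilinear form. With $\mathcal L_\delta\psi(\mathbf x)=\int_{B_\delta(\mathbf x)\cap\Omega}\omega_\delta(|\mathbf y-\mathbf x|)(\psi(\mathbf x)-\psi(\mathbf y))\,\mathrm dv_{\mathbf y}$, $$\mathcal A_\delta(\psi,\mathcal L_\delta\psi)=\int_\Omega\frac1{2\delta}\psi^2\,\mathrm dv+\frac\delta4\int_\Omega\int_\Omega\omega_\delta(|\mathbf y-\mathbf x|)(\psi(\mathbf x)-\psi(\mathbf y))^2\,\mathrm dv_{\mathbf x}\mathrm dv_{\mathbf y},$$ and $a_\delta$ is the associated symmetric bilinear form, i.e. the one with $\mathcal A_\delta(\psi,\mathcal L_\delta\psi)=\frac12a_\delta(\psi,\psi)$: $$a_\delta(\psi,\varphi)=\frac1\delta\int_\Omega\psi\varphi\,\mathrm dv+\frac\delta2\int_\Omega\int_\Omega\omega_\delta(|\mathbf y-\mathbf x|)(\psi(\mathbf x)-\psi(\mathbf y))(\varphi(\mathbf x)-\varphi(\mathbf y))\,\mathrm dv_{\mathbf x}\mathrm dv_{\mathbf y}.$$ Constants and data. $\rho>0$ (density, constant), $G_c>0$, $\bar\eta\ge0$, $\eta=\bar\eta G_c/\delta$, $\Delta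 t>0$, $\mathbf b\in L^2(\Omega;\mathbb{R}^d)$, $\mathbf t\in L^2(\Gamma_{\delta,t};\mathbb{R}^d)$, and loading potential $\ell_u(\mathbf u)=(\mathbf b,\mathbf u)_{L^2(\Omega\setminus\Gamma_\delta)}+(\mathbf t,\mathbf u)_{L^2(\Gamma_{\delta,t})}$. Shifted energy and its derivatives. $A(\mathbf u,\psi)=\int_\Omega\mathcal W_{\delta,de}(\mathbf u,\psi)\,\mathrm dv-\ell_u(\mathbf u)+C_0$ with a constant $C_0>0$; for $\mathbf w\in\mathcal V_{\omega,\mathbf 0}(\Omega)$ and $\varphi\in\mathcal M_\omega(\Omega)$, $$\langle\mathbf F_u(\mathbf u,\psi),\mathbf w\rangle=(\boldsymbol\sigma^{\mathrm d}_\delta(\mathbf u,\psi),\boldsymbol\varepsilon_\delta(\mathbf w))_{L^2(\Omega)}-\ell_u(\mathbf w),\qquad\langle F_\psi(\mathbf u,\psi),\varphi\rangle=\int_\Omega g'(\psi)\mathcal W^+_{\delta,e}(\mathbf u)\varphi\,\mathrm dv$$ (these pairings and $A$ are assumed finite at the arguments used). Scheme. Notation: $D_tz^{k+1}=(z^{k+1}-z^k)/\Delta t$, where for the tentative phase field $D_t\widetilde\psi^{k+1}=(\widetilde\psi^{k+1}-\psi^k)/\Delta t$; $A^k=A(\mathbf u^k,\psi^k)$, $\mathbf F_u^k=\mathbf F_u(\mathbf u^k,\psi^k)$, $F_\psi^k=F_\psi(\mathbf u^k,\psi^k)$, $\xi^{k+1}=r^{k+1}/\sqrt{A^k}$. Given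 $\mathbf u^k\in\mathcal V_{\omega,\mathbf u_g}(\Omega)$, $\mathbf v^k\in L^2(\Omega;\mathbb{R}^d)$, $\psi^k\in\mathcal M_\omega(\Omega)$, $r^k\in\mathbb{R}$, find $\mathbf u^{k+1}\in\mathcal V_{\omega,\mathbf u_g}(\Omega)$, $\mathbf v^{k+1}$, $\widetilde\psi^{k+1}\in\mathcal M_\omega(\Omega)$, $r^{k+1}\in\mathbb{R}$ such that for all $\mathbf w\in\mathcal V_{\omega,\mathbf 0}(\Omega)$ and $\varphi\in\mathcal M_\omega(\Omega)$: $$\mathbf u^{k+1}=\mathbf u^k+\Delta t\,\mathbf v^{k+1},$$ $$\rho(D_t\mathbf v^{k+1},\mathbf w)_{L^2(\Omega\setminus\Gamma_\delta)}+\xi^{k+1}\langle\mathbf F^k_u,\mathbf w\rangle=0,$$ $$\eta(D_t\widetilde\psi^{k+1},\varphi)_{L^2(\Omega)}+G_c\,a_\delta(\widetilde\psi^{k+1},\varphi)+\xi^{k+1}\langle F^k_\psi,\varphi\rangle=0,$$ $$D_tr^{k+1}=\frac1{2\sqrt{A^k}}\Big(\langle\mathbf F^k_u,D_t\mathbf u^{k+1}\rangle+\langle F^k_\psi,D_t\widetilde\psi^{k+1}\rangle\Big).$$ (The irreversibility projection, applied afterwards and not part of the claim, sets $\psi^{k+1}=\max\{\widetilde\psi^{k+1},\psi^k\}$ pointwise.) *)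

theory Defs
  imports "HOL-Analysis.Analysis"
begin

text \<open>Bounded Lipschitz domain: near every boundary point \<open>p\<close> the set is, in the direction of some
  unit vector \<open>e\<close>, the strict epigraph of a Lipschitz function on the hyperplane orthogonal to \<open>e\<close>.\<close>

definition bounded_lipschitz_domain :: "(real^'n) set \<Rightarrow> bool" where
  "bounded_lipschitz_domain \<Omega> \<longleftrightarrow>
     \<Omega> \<noteq> {} \<and> open \<Omega> \<and> connected \<Omega> \<and> bounded \<Omega> \<and>
     (\<forall>p \<in> frontier \<Omega>. \<exists>e r L (\<gamma> :: real^'n \<Rightarrow> real).
        norm e = 1 \<and> r > 0 \<and> L-lipschitz_on {z. z \<bullet> e = 0} \<gamma> \<and>
        \<Omega> \<inter> ball p r = {x \<in> ball p r. \<gamma> (x - (x \<bullet> e) *\<^sub>R e) < x \<bullet> e})"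

definition boundary_layer :: "(real^'n) set \<Rightarrow> real \<Rightarrow> (real^'n) set" where
  "boundary_layer \<Omega> \<delta> = {x \<in> \<Omega>. infdist x (frontier \<Omega>) \<le> \<delta>}"

text \<open>Elements of \<open>L\<^sup>2(S)\<close> are represented by functions on the whole space whose values outside \<open>S\<close> are
  irrelevant; equalities between them are therefore stated almost everywhere on \<open>S\<close>.\<close>

definition L2 :: "(real^'n) set \<Rightarrow> (real^'n \<Rightarrow> 'b::euclidean_space) set" where
  "L2 S = {f \<in> borel_measurable (lebesgue_on S). integrable (lebesgue_on S) (\<lambda>x. (norm (f x))\<^sup>2)}"

definition l2_inner :: "(real^'n) set \<Rightarrow> (real^'n \<Rightarrow> 'b) \<Rightarrow> (real^'n \<Rightarrow> 'b::euclidean_space) \<Rightarrow> real" where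
  "l2_inner S f g = (LINT x|lebesgue_on S. f x \<bullet> g x)"

definition l2_norm :: "(real^'n) set \<Rightarrow> (real^'n \<Rightarrow> 'b::euclidean_space) \<Rightarrow> real" where
  "l2_norm S f = sqrt (LINT x|lebesgue_on S. (norm (f x))\<^sup>2)"

definition outer :: "real^'n \<Rightarrow> real^'n \<Rightarrow> real^'n^'n" where
  "outer a b = (\<chi> i j. a $ i * b $ j)"

text \<open>The radial kernel is given by its profile \<open>\<omega> :: real \<Rightarrow> real\<close>, of which only the values on
  nonnegative arguments matter.\<close>

definition kernel_vec :: "(real \<Rightarrow> real) \<Rightarrow> real^'n \<Rightarrow> real^'n \<Rightarrow> real^'n" where
  "kernel_vec \<omega> x y = \<omega> (norm (y - x)) *\<^sub>R (y - x)"

text \<open>The type argument carries the dimension. The integrability demanded by the moment condition is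
  automatic here: the integral of a non-integrable function is \<open>0\<close>, which is not the identity matrix.\<close>

definition admissible_kernel :: "'n::finite itself \<Rightarrow> real \<Rightarrow> (real \<Rightarrow> real) \<Rightarrow> bool" where
  "admissible_kernel _ \<delta> \<omega> \<longleftrightarrow>
     (\<forall>s\<ge>0. 0 \<le> \<omega> s) \<and>
     (\<lambda>x::real^'n. \<omega> (norm x)) \<in> borel_measurable lebesgue \<and>
     closure {x::real^'n. \<omega> (norm x) \<noteq> 0} = closure (ball 0 \<delta>) \<and>
     (LINT x|lebesgue_on (ball (0::real^'n) \<delta>). outer x (kernel_vec \<omega> 0 x)) = mat 1"

definition V_space :: "(real^'n) set \<Rightarrow> (real \<Rightarrow> real) \<Rightarrow> (real^'n \<Rightarrow> real^'n) set" where
  "V_space \<Omega> \<omega> = {u \<in> L2 \<Omega>.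
     (\<integral>\<^sup>+x. (\<integral>\<^sup>+y. ennreal ((norm (u y - u x))\<^sup>2 * \<omega> (norm (y - x))) \<partial>lebesgue_on \<Omega>)
        \<partial>lebesgue_on \<Omega>) < \<infinity>}"

definition V_space_bc ::
    "(real^'n) set \<Rightarrow> (real \<Rightarrow> real) \<Rightarrow> (real^'n) set \<Rightarrow> (real^'n \<Rightarrow> real^'n) \<Rightarrow> (real^'n \<Rightarrow> real^'n) set" where
  "V_space_bc \<Omega> \<omega> \<Gamma>u h = {u \<in> V_space \<Omega> \<omega>. AE x in lebesgue_on \<Gamma>u. u x = h x}"

text \<open>Fourier transform of the extension of \<open>\<psi>\<close> by zero outside \<open>\<Omega>\<close>, in the normalization with the
  factor \<open>2\<pi>\<close> in the exponent that matches \<open>fourier_symbol\<close>. For bounded \<open>\<Omega>\<close> the integral converges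
  absolutely for every \<open>\<psi> \<in> L\<^sup>2(\<Omega>)\<close>.\<close>

definition fourier_ext :: "(real^'n) set \<Rightarrow> (real^'n \<Rightarrow> real) \<Rightarrow> real^'n \<Rightarrow> complex" where
  "fourier_ext \<Omega> \<psi> \<xi> = (LINT x|lebesgue_on \<Omega>. complex_of_real (\<psi> x) * cis (- (2 * pi * (\<xi> \<bullet> x))))"

definition fourier_symbol :: "real \<Rightarrow> (real \<Rightarrow> real) \<Rightarrow> real^'n \<Rightarrow> real" where
  "fourier_symbol \<delta> \<omega> \<xi> = (LINT y|lebesgue_on (ball 0 \<delta>). \<omega> (norm y) * (1 - cos (2 * pi * (\<xi> \<bullet> y))))"

definition M_space :: "(real^'n) set \<Rightarrow> real \<Rightarrow> (real \<Rightarrow> real) \<Rightarrow> (real^'n \<Rightarrow> real) set" where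
  "M_space \<Omega> \<delta> \<omega> = {\<psi> \<in> L2 \<Omega>.
     (\<integral>\<^sup>+\<xi>. ennreal ((1 + fourier_symbol \<delta> \<omega> \<xi>) * (cmod (fourier_ext \<Omega> \<psi> \<xi>))\<^sup>2) \<partial>lebesgue) < \<infinity>}"

definition nl_gradient ::
    "(real^'n) set \<Rightarrow> real \<Rightarrow> (real \<Rightarrow> real) \<Rightarrow> (real^'n \<Rightarrow> real^'n) \<Rightarrow> real^'n \<Rightarrow> real^'n^'n" where
  "nl_gradient \<Omega> \<delta> \<omega> u x =
     (LINT y|lebesgue_on (ball x \<delta> \<inter> \<Omega>). outer (u y - u x) (kernel_vec \<omega> x y))"

definition nl_strain ::
    "(real^'n) set \<Rightarrow> real \<Rightarrow> (real \<Rightarrow> real) \<Rightarrow> (real^'n \<Rightarrow> real^'n) \<Rightarrow> real^'n \<Rightarrow> real^'n^'n" where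
  "nl_strain \<Omega> \<delta> \<omega> u x = (1/2) *\<^sub>R (nl_gradient \<Omega> \<delta> \<omega> u x + transpose (nl_gradient \<Omega> \<delta> \<omega> u x))"

text \<open>An eigensystem of a symmetric matrix consists of the eigenvalues, with multiplicity, and an
  orthonormal basis of eigenvectors, both indexed by \<open>'n\<close>. One of them is chosen; the energies and
  stresses below do not depend on the choice.\<close>

definition is_eigensystem :: "real^'n^'n \<Rightarrow> ('n \<Rightarrow> real) \<times> ('n \<Rightarrow> real^'n) \<Rightarrow> bool" where
  "is_eigensystem E p \<longleftrightarrow>
     (\<forall>a b. snd p a \<bullet> snd p b = (if a = b then 1 else 0)) \<and>
     (\<forall>a. E *v snd p a = fst p a *\<^sub>R snd p a)"

definition eigval :: "real^'n^'n \<Rightarrow> 'n \<Rightarrow> real" where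
  "eigval E = fst (SOME p. is_eigensystem E p)"

definition eigvec :: "real^'n^'n \<Rightarrow> 'n \<Rightarrow> real^'n" where
  "eigvec E = snd (SOME p. is_eigensystem E p)"

definition ppart :: "real \<Rightarrow> real" where "ppart x = (x + \<bar>x\<bar>) / 2"
definition npart :: "real \<Rightarrow> real" where "npart x = (x - \<bar>x\<bar>) / 2"

text \<open>The argument \<open>E\<close> is the strain at a point; \<open>prt\<close> is \<open>ppart\<close> or \<open>npart\<close>.\<close>

definition W_part :: "(real \<Rightarrow> real) \<Rightarrow> real \<Rightarrow> real \<Rightarrow> real^'n^'n \<Rightarrow> real" where
  "W_part prt lam \<mu> E = lam / 2 * (prt (trace E))\<^sup>2 + \<mu> * (\<Sum>a\<in>UNIV. (prt (eigval E a))\<^sup>2)"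

definition stress_part :: "(real \<Rightarrow> real) \<Rightarrow> real \<Rightarrow> real \<Rightarrow> real^'n^'n \<Rightarrow> real^'n^'n" where
  "stress_part prt lam \<mu> E =
     (lam * prt (trace E)) *\<^sub>R mat 1 +
     (2 * \<mu>) *\<^sub>R (\<Sum>a\<in>UNIV. prt (eigval E a) *\<^sub>R outer (eigvec E a) (eigvec E a))"

definition degr :: "real \<Rightarrow> real" where "degr s = (1 - s)\<^sup>2"

definition W_de ::
    "(real^'n) set \<Rightarrow> real \<Rightarrow> (real \<Rightarrow> real) \<Rightarrow> real \<Rightarrow> real \<Rightarrow>
     (real^'n \<Rightarrow> real^'n) \<Rightarrow> (real^'n \<Rightarrow> real) \<Rightarrow> real^'n \<Rightarrow> real" where
  "W_de \<Omega> \<delta> \<omega> lam \<mu> u \<psi> x =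
     degr (\<psi> x) * W_part ppart lam \<mu> (nl_strain \<Omega> \<delta> \<omega> u x) +
     W_part npart lam \<mu> (nl_strain \<Omega> \<delta> \<omega> u x)"

definition stress_d ::
    "(real^'n) set \<Rightarrow> real \<Rightarrow> (real \<Rightarrow> real) \<Rightarrow> real \<Rightarrow> real \<Rightarrow>
     (real^'n \<Rightarrow> real^'n) \<Rightarrow> (real^'n \<Rightarrow> real) \<Rightarrow> real^'n \<Rightarrow> real^'n^'n" where
  "stress_d \<Omega> \<delta> \<omega> lam \<mu> u \<psi> x =
     degr (\<psi> x) *\<^sub>R stress_part ppart lam \<mu> (nl_strain \<Omega> \<delta> \<omega> u x) +
     stress_part npart lam \<mu> (nl_strain \<Omega> \<delta> \<omega> u x)"

definition loading ::
    "(real^'n) set \<Rightarrow> real \<Rightarrow> (real^'n) set \<Rightarrow> (real^'n \<Rightarrow> real^'n) \<Rightarrow> (real^'n \<Rightarrow> real^'n) \<Rightarrow>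
     (real^'n \<Rightarrow> real^'n) \<Rightarrow> real" where
  "loading \<Omega> \<delta> \<Gamma>t b t u = l2_inner (\<Omega> - boundary_layer \<Omega> \<delta>) b u + l2_inner \<Gamma>t t u"

definition shifted_energy ::
    "(real^'n) set \<Rightarrow> real \<Rightarrow> (real \<Rightarrow> real) \<Rightarrow> real \<Rightarrow> real \<Rightarrow>
     (real^'n) set \<Rightarrow> (real^'n \<Rightarrow> real^'n) \<Rightarrow> (real^'n \<Rightarrow> real^'n) \<Rightarrow> real \<Rightarrow>
     (real^'n \<Rightarrow> real^'n) \<Rightarrow> (real^'n \<Rightarrow> real) \<Rightarrow> real" where
  "shifted_energy \<Omega> \<delta> \<omega> lam \<mu> \<Gamma>t b t C0 u \<psi> =
     (LINT x|lebesgue_on \<Omega>. W_de \<Omega> \<delta> \<omega> lam \<mu> u \<psi> x) - loading \<Omega> \<delta> \<Gamma>t b t u + C0"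

text \<open>The inner product of \<open>real^'n^'n\<close> is the Frobenius product.\<close>

definition F_u ::
    "(real^'n) set \<Rightarrow> real \<Rightarrow> (real \<Rightarrow> real) \<Rightarrow> real \<Rightarrow> real \<Rightarrow>
     (real^'n) set \<Rightarrow> (real^'n \<Rightarrow> real^'n) \<Rightarrow> (real^'n \<Rightarrow> real^'n) \<Rightarrow>
     (real^'n \<Rightarrow> real^'n) \<Rightarrow> (real^'n \<Rightarrow> real) \<Rightarrow> (real^'n \<Rightarrow> real^'n) \<Rightarrow> real" where
  "F_u \<Omega> \<delta> \<omega> lam \<mu> \<Gamma>t b t u \<psi> w =
     l2_inner \<Omega> (stress_d \<Omega> \<delta> \<omega> lam \<mu> u \<psi>) (nl_strain \<Omega> \<delta> \<omega> w) - loading \<Omega> \<delta> \<Gamma>t b t w"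

definition F_psi_density ::
    "(real^'n) set \<Rightarrow> real \<Rightarrow> (real \<Rightarrow> real) \<Rightarrow> real \<Rightarrow> real \<Rightarrow>
     (real^'n \<Rightarrow> real^'n) \<Rightarrow> (real^'n \<Rightarrow> real) \<Rightarrow> (real^'n \<Rightarrow> real) \<Rightarrow> real^'n \<Rightarrow> real" where
  "F_psi_density \<Omega> \<delta> \<omega> lam \<mu> u \<psi> \<phi> x =
     deriv degr (\<psi> x) * W_part ppart lam \<mu> (nl_strain \<Omega> \<delta> \<omega> u x) * \<phi> x"

definition F_psi ::
    "(real^'n) set \<Rightarrow> real \<Rightarrow> (real \<Rightarrow> real) \<Rightarrow> real \<Rightarrow> real \<Rightarrow>
     (real^'n \<Rightarrow> real^'n) \<Rightarrow> (real^'n \<Rightarrow> real) \<Rightarrow> (real^'n \<Rightarrow> real) \<Rightarrow> real" where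
  "F_psi \<Omega> \<delta> \<omega> lam \<mu> u \<psi> \<phi> = (LINT x|lebesgue_on \<Omega>. F_psi_density \<Omega> \<delta> \<omega> lam \<mu> u \<psi> \<phi> x)"

definition crack_functional ::
    "(real^'n) set \<Rightarrow> real \<Rightarrow> (real \<Rightarrow> real) \<Rightarrow> (real^'n \<Rightarrow> real) \<Rightarrow> real" where
  "crack_functional \<Omega> \<delta> \<omega> \<psi> =
     (LINT x|lebesgue_on \<Omega>. 1 / (2 * \<delta>) * (\<psi> x)\<^sup>2) +
     \<delta> / 4 * (LINT y|lebesgue_on \<Omega>. LINT x|lebesgue_on \<Omega>. \<omega> (norm (y - x)) * (\<psi> x - \<psi> y)\<^sup>2)"

definition crack_form ::
    "(real^'n) set \<Rightarrow> real \<Rightarrow> (real \<Rightarrow> real) \<Rightarrow> (real^'n \<Rightarrow> real) \<Rightarrow> (real^'n \<Rightarrow> real) \<Rightarrow> real" where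
  "crack_form \<Omega> \<delta> \<omega> \<psi> \<phi> =
     1 / \<delta> * (LINT x|lebesgue_on \<Omega>. \<psi> x * \<phi> x) +
     \<delta> / 2 * (LINT y|lebesgue_on \<Omega>. LINT x|lebesgue_on \<Omega>.
       \<omega> (norm (y - x)) * (\<psi> x - \<psi> y) * (\<phi> x - \<phi> y))"

definition diff_quot :: "real \<Rightarrow> ('a \<Rightarrow> 'b) \<Rightarrow> ('a \<Rightarrow> 'b) \<Rightarrow> 'a \<Rightarrow> 'b::real_vector" where
  "diff_quot dt znew zold x = (1 / dt) *\<^sub>R (znew x - zold x)"

definition mod_hamiltonian ::
    "(real^'n) set \<Rightarrow> real \<Rightarrow> (real \<Rightarrow> real) \<Rightarrow> real \<Rightarrow> real \<Rightarrow> real \<Rightarrow>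
     (real^'n \<Rightarrow> real^'n) \<Rightarrow> (real^'n \<Rightarrow> real) \<Rightarrow> real \<Rightarrow> real" where
  "mod_hamiltonian \<Omega> \<delta> \<omega> \<rho> Gc C0 v \<psi> r =
     \<rho> / 2 * (l2_norm (\<Omega> - boundary_layer \<Omega> \<delta>) v)\<^sup>2 + Gc * crack_functional \<Omega> \<delta> \<omega> \<psi> + r\<^sup>2 - C0"

end

theory Submission
  imports Defs "HOL-Probability.Characteristic_Functions"
begin

text \<open>
  The energy balance comes from testing. The velocity equation is tested with \<open>D\<^sub>t u\<close>, which vanishes on
  \<open>\<Gamma>\<^sub>u\<close> because the boundary datum does not depend on time and which equals the new velocity; the phase-field
  equation is tested with \<open>D\<^sub>t \<psi>\<close>; the equation for the auxiliary variable is multiplied by \<open>2 r'\<close>. Since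
  \<open>\<xi> = r' / sqrt A\<close>, the nonlinear terms \<open>\<xi> \<langle>F\<^sub>u, D\<^sub>t u\<rangle>\<close> and \<open>\<xi> \<langle>F\<^sub>\<psi>, D\<^sub>t \<psi>\<rangle>\<close> cancel in the
  sum, whatever the energy is. Apart from the viscous term, which is a square already, the
  remaining terms are of the form \<open>B(p, p - q)\<close> with a symmetric bilinear form \<open>B\<close>, and \<open>2 B(p, p - q) = B(p, p) - B(q, q) + B(p - q, p - q)\<close> turns them into the increments
  and the dissipation of the claim, each of the latter being nonnegative.

  The analytic content is that the tests are admissible and that \<open>crack_form\<close> really is bilinear on
  \<open>M_space\<close>. An integral of a non-integrable function is zero by convention, so bilinearity requires that
  the double integral of \<open>\<omega>(\<bar>y - x\<bar>) (\<psi> x - \<psi> y)\<^sup>2\<close> is finite for every \<open>\<psi>\<close> in the space. Membership only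
  says that \<open>(1 + m\<^sub>\<omega>) \<bar>\<psi>^\<bar>\<^sup>2\<close> is integrable. The two are linked by the Plancherel inequality
  \<open>\<integral> f\<^sup>2 \<le> \<integral> \<bar>f^\<bar>\<^sup>2\<close>, applied to the differences \<open>f(x + z) - f x\<close>, whose transform has squared modulus
  \<open>2 (1 - cos (2 \<pi> \<xi> \<bullet> z)) \<bar>f^ \<xi>\<bar>\<^sup>2\<close>; integration against \<open>\<omega>\<close> produces the symbol \<open>m\<^sub>\<omega>\<close>
  (\<open>difference_energy_le\<close>, \<open>M_space_energy\<close>).

  The Plancherel inequality holds for every integrable \<open>f\<close> (\<open>plancherel_le\<close>). For bounded continuous \<open>f\<close>,
  a Gaussian window on the transform corresponds to a convolution with a Gaussian kernel, and the window is
  at most one. The general case follows with Fatou's lemma from averages over small cubes, which converge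
  almost everywhere by Lebesgue's differentiation theorem and do not increase the modulus of the transform.
\<close>

section \<open>Gaussian windows on Euclidean space\<close>

lemma lborel_integral_affine_euclidean:
  fixes f :: "'a::euclidean_space \<Rightarrow> 'b::{banach, second_countable_topology}"
  assumes [measurable]: "f \<in> borel_measurable borel" and c: "c \<noteq> 0"
  shows "(LINT x|lborel. f x) = \<bar>c\<bar> ^ DIM('a) *\<^sub>R (LINT x|lborel. f (t + c *\<^sub>R x))"
  by (subst lborel_affine[OF c, of t]) (simp add: integral_density integral_distr flip: power_abs)

lemma nn_integral_translate:
  fixes f :: "'a::euclidean_space \<Rightarrow> ennreal"
  assumes [measurable]: "f \<in> borel_measurable borel"
  shows "(\<integral>\<^sup>+x. f (t + x) \<partial>lborel) = (\<integral>\<^sup>+x. f x \<partial>lborel)"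
  by (subst (2) lborel_distr_plus[of t, symmetric]) (simp add: nn_integral_distr)

text \<open>The Lebesgue measure of a Euclidean space is the image of a product of one-dimensional ones under
  \<open>f \<mapsto> (\<Sum>b\<in>Basis. f b *\<^sub>R b)\<close>, so integrals of tensor products factor. This reduces the Gaussian in
  several variables to the one-dimensional one.\<close>

lemma integrable_prod_coords:
  fixes g :: "'a::euclidean_space \<Rightarrow> real \<Rightarrow> 'b::{real_normed_field, banach, second_countable_topology}"
  assumes g: "\<And>b. b \<in> Basis \<Longrightarrow> integrable lborel (g b)"
  shows "integrable lborel (\<lambda>x::'a. \<Prod>b\<in>Basis. g b (x \<bullet> b))"
    and "(LINT x|lborel. (\<Prod>b\<in>Basis. g b (x \<bullet> b))) = (\<Prod>b\<in>Basis. (LINT s|lborel. g b s))"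
proof -
  interpret product_sigma_finite "\<lambda>b::'a. lborel :: real measure" ..
  have [measurable]: "g b \<in> borel_measurable borel" if "b \<in> Basis" for b
    using borel_measurable_integrable[OF g[OF that]] by simp
  have coord: "(\<Prod>b\<in>Basis. g b ((\<Sum>b\<in>Basis. f b *\<^sub>R b) \<bullet> b)) = (\<Prod>b\<in>Basis. g b (f b))" for f
    by (intro prod.cong) auto
  have "integrable (\<Pi>\<^sub>M b\<in>Basis. lborel) (\<lambda>f. \<Prod>b\<in>Basis. g b (f b))"
    by (rule product_integrable_prod) (use g in auto)
  then show "integrable lborel (\<lambda>x::'a. \<Prod>b\<in>Basis. g b (x \<bullet> b))"
    by (subst lborel_eq) (simp add: integrable_distr_eq coord del: inner_sum_left_Basis)
  have "(LINT f|(\<Pi>\<^sub>M b\<in>Basis. lborel). (\<Prod>b\<in>Basis. g b (f b))) = (\<Prod>b\<in>Basis. (LINT s|lborel. g b s))"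
    by (rule product_integral_prod) (use g in auto)
  then show "(LINT x|lborel. (\<Prod>b\<in>Basis. g b (x \<bullet> b))) = (\<Prod>b\<in>Basis. (LINT s|lborel. g b s))"
    by (subst lborel_eq) (simp add: integral_distr coord del: inner_sum_left_Basis)
qed

text \<open>A Gaussian of width \<open>1 / (2 \<pi> \<tau>)\<close> on the frequency side: the width is chosen so that its transform
  is the normal density with standard deviation \<open>\<tau>\<close>.\<close>

lemma gaussian_as_normal_density:
  assumes "\<tau> > 0"
  shows "exp (- 2 * pi\<^sup>2 * \<tau>\<^sup>2 * s\<^sup>2) = normal_density 0 (1 / (2 * pi * \<tau>)) s / (\<tau> * sqrt (2 * pi))"
proof -
  have e: "sqrt (2 * pi * (1 / (2 * pi * \<tau>))\<^sup>2) = sqrt (2 * pi) / (2 * pi * \<tau>)"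
    using assms by (subst real_sqrt_mult) simp
  have *: "- (s - 0)\<^sup>2 / (2 * (1 / (2 * pi * \<tau>))\<^sup>2) = - 2 * pi\<^sup>2 * \<tau>\<^sup>2 * s\<^sup>2"
    using assms by (simp add: field_simps power2_eq_square)
  have "1 / (q / (2 * pi * \<tau>)) / (\<tau> * q) = 2 * pi / (q * q)" for q
    using assms by (cases "q = 0") (simp_all add: field_simps)
  from this[of "sqrt (2 * pi)"]
  have "1 / (sqrt (2 * pi) / (2 * pi * \<tau>)) / (\<tau> * sqrt (2 * pi)) = 1" by simp
  then have "k * E / (\<tau> * sqrt (2 * pi)) = E" if "k = 1 / (sqrt (2 * pi) / (2 * pi * \<tau>))" for k E
    unfolding that by (metis mult.commute mult_1 times_divide_eq_left)
  with * show ?thesis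
    unfolding normal_density_def e by metis
qed

lemma gaussian_integrable_1d:
  assumes "\<tau> > 0"
  shows "integrable lborel (\<lambda>s. exp (- 2 * pi\<^sup>2 * \<tau>\<^sup>2 * s\<^sup>2))"
  unfolding gaussian_as_normal_density[OF assms]
  by (rule integrable_divide_zero) (use assms in simp)

text \<open>Rescaling by \<open>1 / (2 \<pi> \<tau>)\<close> turns the integral into the characteristic function of the standard
  normal distribution, evaluated at \<open>z / \<tau>\<close>.\<close>

lemma gaussian_transform_1d:
  assumes \<tau>: "\<tau> > 0"
  shows "integrable lborel (\<lambda>s. complex_of_real (exp (- 2 * pi\<^sup>2 * \<tau>\<^sup>2 * s\<^sup>2)) * cis (2 * pi * (s * z)))"
    and "(LINT s|lborel. complex_of_real (exp (- 2 * pi\<^sup>2 * \<tau>\<^sup>2 * s\<^sup>2)) * cis (2 * pi * (s * z)))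
      = complex_of_real (normal_density 0 \<tau> z)"
proof -
  from gaussian_integrable_1d[OF \<tau>]
  show "integrable lborel
      (\<lambda>s. complex_of_real (exp (- 2 * pi\<^sup>2 * \<tau>\<^sup>2 * s\<^sup>2)) * cis (2 * pi * (s * z)))"
    by (rule Bochner_Integration.integrable_bound) (auto simp: norm_mult cis_conv_exp)
  let ?c = "1 / (2 * pi * \<tau>)"
  have c: "?c > 0" using \<tau> by simp
  have "(LINT s|lborel. complex_of_real (exp (- 2 * pi\<^sup>2 * \<tau>\<^sup>2 * s\<^sup>2)) * cis (2 * pi * (s * z)))
      = \<bar>?c\<bar> *\<^sub>R (LINT s|lborel. complex_of_real (exp (- 2 * pi\<^sup>2 * \<tau>\<^sup>2 * (0 + ?c * s)\<^sup>2)) * cis (2 * pi * ((0 + ?c * s) * z)))"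
    by (rule lborel_integral_real_affine) (use c in linarith)
  also have "\<bar>?c\<bar> = ?c" using c by (rule abs_of_pos)
  also have "(\<lambda>s. complex_of_real (exp (- 2 * pi\<^sup>2 * \<tau>\<^sup>2 * (0 + ?c * s)\<^sup>2)) * cis (2 * pi * ((0 + ?c * s) * z)))
    = (\<lambda>s. sqrt (2 * pi) *\<^sub>R (std_normal_density s *\<^sub>R iexp (z / \<tau> * s)))"
  proof
    fix s
    have 1: "- 2 * pi\<^sup>2 * \<tau>\<^sup>2 * (0 + ?c * s)\<^sup>2 = - s\<^sup>2 / 2"
      using \<tau> by (simp add: power_mult_distrib power_divide)
    have 2: "2 * pi * ((0 + ?c * s) * z) = z / \<tau> * s"
      using \<tau> by simp
    have 3: "exp (- s\<^sup>2 / 2) = sqrt (2 * pi) * std_normal_density s"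
      by (simp add: std_normal_density_def)
    show "complex_of_real (exp (- 2 * pi\<^sup>2 * \<tau>\<^sup>2 * (0 + ?c * s)\<^sup>2)) * cis (2 * pi * ((0 + ?c * s) * z))
      = sqrt (2 * pi) *\<^sub>R (std_normal_density s *\<^sub>R iexp (z / \<tau> * s))"
      unfolding 1 2 3 cis_conv_exp scaleR_conv_of_real of_real_mult by (simp only: mult.assoc)
  qed
  also have "(LINT s|lborel. sqrt (2 * pi) *\<^sub>R (std_normal_density s *\<^sub>R iexp (z / \<tau> * s)))
     = sqrt (2 * pi) *\<^sub>R char std_normal_distribution (z / \<tau>)"
    unfolding char_def integral_scaleR_right by (subst integral_density) (auto simp: normal_density_nonneg)
  also have "\<dots> = sqrt (2 * pi) *\<^sub>R of_real (exp (- (z / \<tau>)\<^sup>2 / 2))"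
    by (simp add: char_std_normal_distribution)
  also have "?c *\<^sub>R \<dots> = complex_of_real (?c * sqrt (2 * pi) * exp (- (z / \<tau>)\<^sup>2 / 2))"
    by (simp add: scaleR_conv_of_real)
  also have "?c * sqrt (2 * pi) * exp (- (z / \<tau>)\<^sup>2 / 2) = normal_density 0 \<tau> z"
  proof -
    have "sqrt (2 * pi * \<tau>\<^sup>2) = sqrt (2 * pi) * \<tau>" using \<tau> by (simp add: real_sqrt_mult)
    moreover have "2 * pi = sqrt (2 * pi) * sqrt (2 * pi)" by simp
    then have "?c * sqrt (2 * pi) = 1 / (sqrt (2 * pi) * \<tau>)"
      using \<tau> by (simp add: field_simps)
    ultimately show ?thesis by (simp add: normal_density_def power_divide)
  qed
  finally show "(LINT s|lborel. complex_of_real (exp (- 2 * pi\<^sup>2 * \<tau>\<^sup>2 * s\<^sup>2)) * cis (2 * pi * (s * z)))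
      = complex_of_real (normal_density 0 \<tau> z)" .
qed

text \<open>The function \<open>exp (- 2 \<pi>\<^sup>2 \<tau>\<^sup>2 \<bar>\<xi>\<bar>\<^sup>2)\<close>, written as a product over the coordinates.\<close>

definition gauss_window :: "real \<Rightarrow> 'a::euclidean_space \<Rightarrow> real" where
  "gauss_window \<tau> \<xi> = (\<Prod>b\<in>Basis. exp (- 2 * pi\<^sup>2 * \<tau>\<^sup>2 * (\<xi> \<bullet> b)\<^sup>2))"

definition gauss_kernel :: "real \<Rightarrow> 'a::euclidean_space \<Rightarrow> real" where
  "gauss_kernel \<tau> z = (\<Prod>b\<in>Basis. normal_density 0 \<tau> (z \<bullet> b))"

lemma gauss_window_measurable [measurable]: "gauss_window \<tau> \<in> borel_measurable borel"
  unfolding gauss_window_def by measurable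

lemma gauss_kernel_measurable [measurable]: "gauss_kernel \<tau> \<in> borel_measurable borel"
  unfolding gauss_kernel_def by measurable

lemma gauss_window_nonneg: "0 \<le> gauss_window \<tau> \<xi>"
  and gauss_window_le_1: "gauss_window \<tau> \<xi> \<le> 1"
  unfolding gauss_window_def by (auto intro!: prod_nonneg prod_le_1)

lemma gauss_kernel_nonneg: "0 \<le> gauss_kernel \<tau> z"
  unfolding gauss_kernel_def by (auto intro!: prod_nonneg)

lemma cis_inner_eq_prod: "cis (2 * pi * (\<xi> \<bullet> z)) = (\<Prod>b\<in>Basis. cis (2 * pi * ((\<xi> \<bullet> b) * (z \<bullet> b))))"
proof -
  have "(\<Prod>b\<in>B. cis (f b)) = cis (\<Sum>b\<in>B. f b)" if "finite B" for B :: "'a set" and f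
    using that by induction (auto simp: cis_mult)
  then show ?thesis
    by (simp add: euclidean_inner[of \<xi> z] sum_distrib_left)
qed

lemma gaussian_transform:
  fixes z :: "'a::euclidean_space"
  assumes \<tau>: "\<tau> > 0"
  shows "(LINT \<xi>|lborel. complex_of_real (gauss_window \<tau> \<xi>) * cis (2 * pi * (\<xi> \<bullet> z)))
      = complex_of_real (gauss_kernel \<tau> z)"
proof -
  let ?g = "\<lambda>(b::'a) s. complex_of_real (exp (- 2 * pi\<^sup>2 * \<tau>\<^sup>2 * s\<^sup>2)) * cis (2 * pi * (s * (z \<bullet> b)))"
  have "(\<lambda>\<xi>. complex_of_real (gauss_window \<tau> \<xi>) * cis (2 * pi * (\<xi> \<bullet> z))) = (\<lambda>\<xi>. \<Prod>b\<in>Basis. ?g b (\<xi> \<bullet> b))"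
    by (simp add: gauss_window_def cis_inner_eq_prod prod.distrib)
  then show ?thesis
    using integrable_prod_coords(2)[of ?g] gaussian_transform_1d[OF \<tau>]
    by (simp add: gauss_kernel_def)
qed

lemma gauss_window_integrable:
  assumes \<tau>: "\<tau> > 0"
  shows "integrable lborel (gauss_window \<tau> :: 'a::euclidean_space \<Rightarrow> real)"
  unfolding gauss_window_def
  by (rule integrable_prod_coords(1)) (rule gaussian_integrable_1d[OF \<tau>])

lemma gauss_kernel_integrable:
  assumes \<tau>: "\<tau> > 0"
  shows "integrable lborel (gauss_kernel \<tau> :: 'a::euclidean_space \<Rightarrow> real)"
    and "(LINT z|lborel. gauss_kernel \<tau> (z::'a)) = 1"
  unfolding gauss_kernel_def
  using integrable_prod_coords[of "\<lambda>_::'a. normal_density 0 \<tau>"] \<tau> by auto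

text \<open>The kernels are dilates of one probability density. After the substitution \<open>x = y - \<tau> z\<close> the
  convolution with \<open>gauss_kernel \<tau>\<close> is an average against a fixed density, to which dominated convergence
  applies as \<open>\<tau>\<close> tends to \<open>0\<close>.\<close>

lemma gauss_kernel_scale:
  fixes z :: "'a::euclidean_space"
  assumes \<tau>: "\<tau> > 0"
  shows "\<tau> ^ DIM('a) * gauss_kernel \<tau> (\<tau> *\<^sub>R z) = gauss_kernel 1 z"
proof -
  have "\<tau> * normal_density 0 \<tau> (\<tau> * s) = normal_density 0 1 s" for s
    using \<tau> by (simp add: normal_density_def real_sqrt_mult power_mult_distrib)
  then have "gauss_kernel 1 z = (\<Prod>b\<in>(Basis::'a set). \<tau> * normal_density 0 \<tau> (\<tau> * (z \<bullet> b)))"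
    by (simp add: gauss_kernel_def)
  then show ?thesis by (simp add: prod.distrib gauss_kernel_def)
qed

section \<open>The Plancherel inequality for bounded continuous functions\<close>

definition fourier :: "('a::euclidean_space \<Rightarrow> real) \<Rightarrow> 'a \<Rightarrow> complex" where
  "fourier f \<xi> = (LINT x|lborel. complex_of_real (f x) * cis (- (2 * pi * (\<xi> \<bullet> x))))"

lemma cis_measurable [measurable (raw)]:
  "g \<in> borel_measurable M \<Longrightarrow> (\<lambda>x. cis (g x)) \<in> borel_measurable M"
  by (simp add: cis_conv_exp)

lemma fourier_measurable [measurable]:
  assumes [measurable]: "f \<in> borel_measurable borel"
  shows "fourier f \<in> borel_measurable borel"
  unfolding fourier_def by measurable

lemma fourier_integrand_integrable:
  fixes f :: "'a::euclidean_space \<Rightarrow> real"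
  assumes "integrable lborel f"
  shows "integrable lborel (\<lambda>x. complex_of_real (f x) * cis (- (2 * pi * (\<xi> \<bullet> x))))"
  using assms
  by (rule Bochner_Integration.integrable_bound) (use borel_measurable_integrable[OF assms] in \<open>auto simp: norm_mult\<close>)

lemma norm_fourier_le: "cmod (fourier f \<xi>) \<le> (LINT x|lborel. \<bar>f x\<bar>)"
  unfolding fourier_def
  by (rule order_trans[OF integral_norm_bound]) (simp add: norm_mult)

text \<open>Writing \<open>\<bar>f^\<bar>\<^sup>2\<close> as \<open>f^\<close> times its conjugate and expanding both transforms gives a triple integral.
  The window makes it absolutely convergent, so the frequency integral may be carried out first; it turns
  \<open>cis (2 \<pi> \<xi> \<bullet> (y - x))\<close> into the Gaussian kernel at \<open>y - x\<close>.\<close>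

lemma windowed_energy:
  fixes f :: "'a::euclidean_space \<Rightarrow> real"
  assumes f: "integrable lborel f" and \<tau>: "\<tau> > 0"
  shows "(LINT \<xi>|lborel. gauss_window \<tau> \<xi> * (cmod (fourier f \<xi>))\<^sup>2)
      = (LINT y|lborel. f y * (LINT z|lborel. f (y - \<tau> *\<^sub>R z) * gauss_kernel 1 z))"
proof -
  have [measurable]: "f \<in> borel_measurable borel"
    using borel_measurable_integrable[OF f] by simp
  let ?\<phi> = "\<lambda>\<xi>::'a. complex_of_real (gauss_window \<tau> \<xi>)"
  let ?F = "\<lambda>x. complex_of_real (f x)"
  let ?C = "LINT x|lborel. \<bar>f x\<bar>"
  have prodint: "integrable (lborel \<Otimes>\<^sub>M lborel) (\<lambda>(y, \<xi>). f y * gauss_window \<tau> (\<xi>::'a))"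
    using f gauss_window_integrable[OF \<tau>, where 'a='a]
    by (intro lborel_pair.Fubini_integrable) (simp_all add: abs_mult)
  have conv: "(LINT x|lborel. f x * gauss_kernel \<tau> (y - x)) = (LINT z|lborel. f (y - \<tau> *\<^sub>R z) * gauss_kernel 1 z)" for y
  proof -
    have "(LINT x|lborel. f x * gauss_kernel \<tau> (y - x))
      = \<bar>-\<tau>\<bar> ^ DIM('a) *\<^sub>R (LINT z|lborel. f (y + (-\<tau>) *\<^sub>R z) * gauss_kernel \<tau> (y - (y + (-\<tau>) *\<^sub>R z)))"
      by (rule lborel_integral_affine_euclidean) (use \<tau> in auto)
    also have "\<dots> = (LINT z|lborel. f (y - \<tau> *\<^sub>R z) * (\<tau> ^ DIM('a) * gauss_kernel \<tau> (\<tau> *\<^sub>R z)))"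
      using \<tau> by (simp add: mult.left_commute)
    finally show ?thesis by (simp add: gauss_kernel_scale[OF \<tau>])
  qed
  \<comment> \<open>synthesis: inserting the window turns the inverse transform into a convolution\<close>
  have syn: "(LINT \<xi>|lborel. ?\<phi> \<xi> * fourier f \<xi> * cis (2 * pi * (\<xi> \<bullet> y)))
      = complex_of_real (LINT x|lborel. f x * gauss_kernel \<tau> (y - x))" for y
  proof -
    have "(LINT \<xi>|lborel. ?\<phi> \<xi> * fourier f \<xi> * cis (2 * pi * (\<xi> \<bullet> y)))
      = (LINT \<xi>|lborel. LINT x|lborel. ?F x * (?\<phi> \<xi> * cis (2 * pi * (\<xi> \<bullet> (y - x)))))"
    proof (rule Bochner_Integration.integral_cong[OF refl])
      fix \<xi> :: 'a
      have cis: "?\<phi> \<xi> * cis (2 * pi * (\<xi> \<bullet> y)) * (?F x * cis (- (2 * pi * (\<xi> \<bullet> x))))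
          = ?F x * (?\<phi> \<xi> * cis (2 * pi * (\<xi> \<bullet> (y - x))))" for x
      proof -
        have "cis (2 * pi * (\<xi> \<bullet> (y - x))) = cis (2 * pi * (\<xi> \<bullet> y)) * cis (- (2 * pi * (\<xi> \<bullet> x)))"
          by (simp add: cis_mult inner_diff_right right_diff_distrib del: cis_inverse cis_divide)
        then show ?thesis by (simp only: mult_ac)
      qed
      have "?\<phi> \<xi> * fourier f \<xi> * cis (2 * pi * (\<xi> \<bullet> y))
        = ?\<phi> \<xi> * cis (2 * pi * (\<xi> \<bullet> y)) * fourier f \<xi>" by (simp only: mult_ac)
      also have "\<dots> = (LINT x|lborel. ?\<phi> \<xi> * cis (2 * pi * (\<xi> \<bullet> y)) * (?F x * cis (- (2 * pi * (\<xi> \<bullet> x)))))"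
        unfolding fourier_def by (rule integral_mult_right_zero[symmetric])
      finally show "?\<phi> \<xi> * fourier f \<xi> * cis (2 * pi * (\<xi> \<bullet> y))
        = (LINT x|lborel. ?F x * (?\<phi> \<xi> * cis (2 * pi * (\<xi> \<bullet> (y - x)))))"
        unfolding cis .
    qed
    also have "\<dots> = (LINT x|lborel. LINT \<xi>|lborel. ?F x * (?\<phi> \<xi> * cis (2 * pi * (\<xi> \<bullet> (y - x)))))"
    proof (rule lborel_pair.Fubini_integral)
      show "integrable (lborel \<Otimes>\<^sub>M lborel) (\<lambda>(x, \<xi>). ?F x * (?\<phi> \<xi> * cis (2 * pi * (\<xi> \<bullet> (y - x)))))"
        by (rule Bochner_Integration.integrable_bound[OF prodint])
          (auto simp: norm_mult)
    qed
    also have "\<dots> = (LINT x|lborel. complex_of_real (f x * gauss_kernel \<tau> (y - x)))"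
      by (simp add: gaussian_transform[OF \<tau>])
    finally show ?thesis by (simp only: integral_complex_of_real)
  qed
  have "complex_of_real (LINT \<xi>|lborel. gauss_window \<tau> \<xi> * (cmod (fourier f \<xi>))\<^sup>2)
      = (LINT \<xi>|lborel. LINT y|lborel. ?F y * (?\<phi> \<xi> * fourier f \<xi> * cis (2 * pi * (\<xi> \<bullet> y))))"
  proof -
    have "complex_of_real (gauss_window \<tau> \<xi> * (cmod (fourier f \<xi>))\<^sup>2)
        = (LINT y|lborel. ?F y * (?\<phi> \<xi> * fourier f \<xi> * cis (2 * pi * (\<xi> \<bullet> y))))" for \<xi>
    proof -
      have "cnj (fourier f \<xi>) = (LINT y|lborel. ?F y * cis (2 * pi * (\<xi> \<bullet> y)))"
        unfolding fourier_def by (subst Bochner_Integration.integral_cnj[symmetric]) (simp add: cis_cnj)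
      moreover have "complex_of_real (gauss_window \<tau> \<xi> * (cmod (fourier f \<xi>))\<^sup>2)
        = ?\<phi> \<xi> * fourier f \<xi> * cnj (fourier f \<xi>)"
        unfolding of_real_mult complex_norm_square by (simp only: mult.assoc)
      ultimately have "complex_of_real (gauss_window \<tau> \<xi> * (cmod (fourier f \<xi>))\<^sup>2)
        = (LINT y|lborel. ?\<phi> \<xi> * fourier f \<xi> * (?F y * cis (2 * pi * (\<xi> \<bullet> y))))"
        by (simp only: integral_mult_right_zero)
      then show ?thesis by (simp only: mult_ac)
    qed
    then show ?thesis by (simp only: integral_complex_of_real[symmetric])
  qed
  also have "\<dots> = (LINT y|lborel. LINT \<xi>|lborel. ?F y * (?\<phi> \<xi> * fourier f \<xi> * cis (2 * pi * (\<xi> \<bullet> y))))"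
  proof (rule lborel_pair.Fubini_integral)
    show "integrable (lborel \<Otimes>\<^sub>M lborel) (\<lambda>(y, \<xi>). ?F y * (?\<phi> \<xi> * fourier f \<xi> * cis (2 * pi * (\<xi> \<bullet> y))))"
    proof (rule Bochner_Integration.integrable_bound[OF integrable_mult_left[OF prodint, of ?C]])
      show "AE p in lborel \<Otimes>\<^sub>M lborel. norm (case p of (y, \<xi>) \<Rightarrow> ?F y * (?\<phi> \<xi> * fourier f \<xi> * cis (2 * pi * (\<xi> \<bullet> y))))
          \<le> norm ((case p of (y, \<xi>) \<Rightarrow> f y * gauss_window \<tau> \<xi>) * ?C)"
        using norm_fourier_le[of f]
        by (intro AE_I2) (auto simp: norm_mult abs_mult mult.assoc split_beta intro!: mult_left_mono)
    qed measurable
  qed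
  also have "\<dots> = (LINT y|lborel. complex_of_real (f y * (LINT x|lborel. f x * gauss_kernel \<tau> (y - x))))"
    by (simp add: syn)
  also have "\<dots> = complex_of_real (LINT y|lborel. f y * (LINT x|lborel. f x * gauss_kernel \<tau> (y - x)))"
    by (rule integral_complex_of_real)
  finally show ?thesis by (simp only: of_real_eq_iff conv)
qed

text \<open>Continuity and boundedness make the Gaussian averages converge pointwise and boundedly to \<open>f\<close>, so
  the right-hand side of \<open>windowed_energy\<close> tends to \<open>\<integral> f\<^sup>2\<close>, while its left-hand side stays below
  \<open>\<integral> \<bar>f^\<bar>\<^sup>2\<close> since the window is at most \<open>1\<close>. If the transform is not square integrable there is nothing
  to prove, hence the formulation with nonnegative integrals.\<close>

lemma plancherel_le_continuous:
  fixes f :: "'a::euclidean_space \<Rightarrow> real"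
  assumes f: "integrable lborel f" and cont: "continuous_on UNIV f" and bd: "\<And>x. \<bar>f x\<bar> \<le> B"
  shows "(\<integral>\<^sup>+x. ennreal ((f x)\<^sup>2) \<partial>lborel) \<le> (\<integral>\<^sup>+\<xi>. ennreal ((cmod (fourier f \<xi>))\<^sup>2) \<partial>lborel)"
proof -
  have [measurable]: "f \<in> borel_measurable borel"
    using borel_measurable_integrable[OF f] by simp
  have B: "B \<ge> 0" using bd[of 0] by linarith
  define \<tau> :: "nat \<Rightarrow> real" where "\<tau> n = 1 / real (Suc n)" for n
  have \<tau>: "\<tau> n > 0" for n by (simp add: \<tau>_def)
  have \<tau>0: "\<tau> \<longlonglongrightarrow> 0" unfolding \<tau>_def using LIMSEQ_inverse_real_of_nat by (simp add: inverse_eq_divide)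
  define g where "g n y = (LINT z|lborel. f (y - \<tau> n *\<^sub>R z) * gauss_kernel 1 z)" for n y
  have [measurable]: "g n \<in> borel_measurable borel" for n unfolding g_def by measurable
  have gb: "\<bar>g n y\<bar> \<le> B" for n y
  proof -
    have "\<bar>g n y\<bar> \<le> (LINT z|lborel. B * gauss_kernel 1 (z::'a))"
      unfolding g_def
    proof (rule integral_abs_bound_integral)
      show "integrable lborel (\<lambda>z. B * gauss_kernel 1 (z::'a))"
        using gauss_kernel_integrable(1)[of 1, where 'a='a] by simp
      then show "integrable lborel (\<lambda>z. f (y - \<tau> n *\<^sub>R z) * gauss_kernel 1 z)"
        by (rule Bochner_Integration.integrable_bound)
           (use bd B in \<open>auto simp: abs_mult intro!: mult_right_mono\<close>)
    qed (use bd in \<open>auto simp: abs_mult gauss_kernel_nonneg intro!: mult_right_mono\<close>)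
    then show ?thesis using gauss_kernel_integrable(2)[of 1, where 'a='a] by simp
  qed
  have lim: "(\<lambda>n. g n y) \<longlonglongrightarrow> f y" for y
  proof -
    have "(\<lambda>n. g n y) \<longlonglongrightarrow> (LINT z|lborel. f y * gauss_kernel 1 (z::'a))"
      unfolding g_def
    proof (rule integral_dominated_convergence[where w="\<lambda>z::'a. B * gauss_kernel 1 z"])
      show "integrable lborel (\<lambda>z. B * gauss_kernel 1 (z::'a))"
        using gauss_kernel_integrable(1)[of 1, where 'a='a] by simp
      have "(\<lambda>n. f (y - \<tau> n *\<^sub>R z)) \<longlonglongrightarrow> f y" for z
      proof (rule isCont_tendsto_compose[where g=f])
        show "isCont f y" using cont by (simp add: continuous_on_eq_continuous_at)
        have "(\<lambda>n. y - \<tau> n *\<^sub>R z) \<longlonglongrightarrow> y - 0 *\<^sub>R z"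
          by (intro tendsto_intros \<tau>0)
        then show "(\<lambda>n. y - \<tau> n *\<^sub>R z) \<longlonglongrightarrow> y" by simp
      qed
      then show "AE z in lborel. (\<lambda>n. f (y - \<tau> n *\<^sub>R z) * gauss_kernel 1 z) \<longlonglongrightarrow> f y * gauss_kernel 1 z"
        by (auto intro!: tendsto_mult_right)
    qed (use bd in \<open>auto simp: abs_mult gauss_kernel_nonneg intro!: mult_right_mono\<close>)
    then show ?thesis using gauss_kernel_integrable(2)[of 1, where 'a='a] by simp
  qed
  have sq: "(\<lambda>n. LINT y|lborel. f y * g n y) \<longlonglongrightarrow> (LINT y|lborel. f y * f y)"
  proof (rule integral_dominated_convergence[where w="\<lambda>y. \<bar>f y\<bar> * B"])
    show "integrable lborel (\<lambda>y. \<bar>f y\<bar> * B)" using f by simp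
  qed (use lim gb in \<open>auto simp: abs_mult intro!: tendsto_mult_left mult_left_mono\<close>)
  have "integrable lborel (\<lambda>y. \<bar>f y\<bar> * B)" using f by simp
  then have "integrable lborel (\<lambda>y. f y * f y)"
  proof (rule Bochner_Integration.integrable_bound)
    show "AE y in lborel. norm (f y * f y) \<le> norm (\<bar>f y\<bar> * B)"
      using bd B by (intro AE_I2) (simp add: abs_mult mult_left_mono del: abs_mult_self_eq)
  qed measurable
  then have "(\<integral>\<^sup>+x. ennreal ((f x)\<^sup>2) \<partial>lborel) = ennreal (LINT y|lborel. f y * f y)"
    by (simp add: nn_integral_eq_integral power2_eq_square)
  also have "\<dots> \<le> (\<integral>\<^sup>+\<xi>. ennreal ((cmod (fourier f \<xi>))\<^sup>2) \<partial>lborel)"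
  proof (rule LIMSEQ_le_const2[OF tendsto_ennrealI[OF sq]], intro exI allI impI)
    fix n
    have int: "integrable lborel (\<lambda>\<xi>::'a. gauss_window (\<tau> n) \<xi> * (cmod (fourier f \<xi>))\<^sup>2)"
    proof (rule Bochner_Integration.integrable_bound[OF integrable_mult_left[OF gauss_window_integrable[OF \<tau>[of n]],
          of "(LINT x|lborel. \<bar>f x\<bar>)\<^sup>2"]])
      show "AE \<xi>::'a in lborel. norm (gauss_window (\<tau> n) \<xi> * (cmod (fourier f \<xi>))\<^sup>2)
          \<le> norm (gauss_window (\<tau> n) \<xi> * (LINT x|lborel. \<bar>f x\<bar>)\<^sup>2)"
        using norm_fourier_le[of f]
        by (auto simp: abs_mult intro!: mult_left_mono power_mono)
    qed measurable
    have "ennreal (LINT y|lborel. f y * g n y) = ennreal (LINT \<xi>|lborel. gauss_window (\<tau> n) \<xi> * (cmod (fourier f \<xi>))\<^sup>2)"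
      by (simp add: windowed_energy[OF f \<tau>] g_def)
    also have "\<dots> = (\<integral>\<^sup>+\<xi>. ennreal (gauss_window (\<tau> n) \<xi> * (cmod (fourier f \<xi>))\<^sup>2) \<partial>lborel)"
      using int by (simp add: nn_integral_eq_integral gauss_window_nonneg)
    also have "\<dots> \<le> (\<integral>\<^sup>+\<xi>. ennreal ((cmod (fourier f \<xi>))\<^sup>2) \<partial>lborel)"
      by (intro nn_integral_mono ennreal_leI) (simp add: mult_left_le_one_le gauss_window_nonneg gauss_window_le_1)
    finally show "ennreal (LINT y|lborel. f y * g n y) \<le> (\<integral>\<^sup>+\<xi>. ennreal ((cmod (fourier f \<xi>))\<^sup>2) \<partial>lborel)" .
  qed
  finally show ?thesis .
qed

section \<open>The Plancherel inequality for integrable functions\<close>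

lemma integrable_translate_iff:
  fixes f :: "'a::euclidean_space \<Rightarrow> 'b::{banach, second_countable_topology}"
  shows "integrable lborel (\<lambda>x. f (t + x)) \<longleftrightarrow> integrable lborel f"
proof -
  have imp: "integrable lborel (\<lambda>x. g (s + x))" if "integrable lborel g" for g :: "'a \<Rightarrow> 'b" and s
  proof -
    have [measurable]: "g \<in> borel_measurable borel"
      using borel_measurable_integrable[OF that] by simp
    have "integrable (distr lborel borel ((+) s)) g"
      using that by (simp add: lborel_distr_plus)
    then show ?thesis by (simp add: integrable_distr_eq)
  qed
  show ?thesis using imp[of f t] imp[of "\<lambda>x. f (t + x)" "-t"] by auto
qed

lemma fourier_translate:
  fixes f :: "'a::euclidean_space \<Rightarrow> real"
  assumes f: "integrable lborel f"
  shows "fourier (\<lambda>x. f (x + h)) \<xi> = cis (2 * pi * (\<xi> \<bullet> h)) * fourier f \<xi>"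
proof -
  have [measurable]: "f \<in> borel_measurable borel"
    using borel_measurable_integrable[OF f] by simp
  have "fourier f \<xi> = (LINT x|lborel. complex_of_real (f (h + 1 *\<^sub>R x)) * cis (- (2 * pi * (\<xi> \<bullet> (h + 1 *\<^sub>R x)))))"
    unfolding fourier_def
    by (subst lborel_integral_affine_euclidean[of _ 1 h]) auto
  also have "\<dots> = (LINT x|lborel. cis (- (2 * pi * (\<xi> \<bullet> h))) * (complex_of_real (f (x + h)) * cis (- (2 * pi * (\<xi> \<bullet> x)))))"
  proof (intro Bochner_Integration.integral_cong refl)
    fix x
    have "cis (- (2 * pi * (\<xi> \<bullet> (h + 1 *\<^sub>R x)))) = cis (- (2 * pi * (\<xi> \<bullet> h))) * cis (- (2 * pi * (\<xi> \<bullet> x)))"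
      by (simp add: cis_mult inner_add_right distrib_left del: cis_inverse cis_divide)
    then show "complex_of_real (f (h + 1 *\<^sub>R x)) * cis (- (2 * pi * (\<xi> \<bullet> (h + 1 *\<^sub>R x))))
      = cis (- (2 * pi * (\<xi> \<bullet> h))) * (complex_of_real (f (x + h)) * cis (- (2 * pi * (\<xi> \<bullet> x))))"
      by (simp only: scaleR_one add.commute[of h x] mult_ac)
  qed
  also have "\<dots> = cis (- (2 * pi * (\<xi> \<bullet> h))) * fourier (\<lambda>x. f (x + h)) \<xi>"
    by (simp only: fourier_def integral_mult_right_zero)
  finally show ?thesis
    by (simp add: cis_mult mult.assoc[symmetric] del: cis_inverse)
qed

lemma norm_cis_minus_1_square: "(cmod (cis t - 1))\<^sup>2 = 2 * (1 - cos t)"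
proof -
  have "(cmod (cis t - 1))\<^sup>2 = (cos t - 1)\<^sup>2 + (sin t)\<^sup>2"
    by (simp add: cmod_power2)
  also have "\<dots> = (cos t)\<^sup>2 + (sin t)\<^sup>2 + 1 - 2 * cos t"
    by (simp add: power2_eq_square algebra_simps)
  finally show ?thesis by simp
qed

text \<open>A translation by \<open>h\<close> multiplies the transform by \<open>cis (2 \<pi> \<xi> \<bullet> h)\<close>, and
  \<open>\<bar>cis t - 1\<bar>\<^sup>2 = 2 (1 - cos t)\<close>. This is the factor from which the symbol of the nonlocal operator is built.\<close>

lemma fourier_difference:
  fixes f :: "'a::euclidean_space \<Rightarrow> real"
  assumes f: "integrable lborel f"
  shows "(cmod (fourier (\<lambda>x. f (x + h) - f x) \<xi>))\<^sup>2 = 2 * (1 - cos (2 * pi * (\<xi> \<bullet> h))) * (cmod (fourier f \<xi>))\<^sup>2"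
proof -
  have f': "integrable lborel (\<lambda>x. f (x + h))"
    using f integrable_translate_iff[of f h] by (simp add: add.commute)
  have "fourier (\<lambda>x. f (x + h) - f x) \<xi> = fourier (\<lambda>x. f (x + h)) \<xi> - fourier f \<xi>"
    unfolding fourier_def
    by (simp add: left_diff_distrib Bochner_Integration.integral_diff fourier_integrand_integrable f f')
  also have "\<dots> = (cis (2 * pi * (\<xi> \<bullet> h)) - 1) * fourier f \<xi>"
    by (simp add: fourier_translate[OF f] left_diff_distrib)
  finally show ?thesis
    by (simp add: norm_mult power_mult_distrib norm_cis_minus_1_square)
qed

text \<open>The transform of an average of translates is \<open>f^\<close> times the transform of the averaging density, up
  to a reflection, and the latter has modulus at most \<open>1\<close>.\<close>

lemma averaging:
  fixes f k :: "'a::euclidean_space \<Rightarrow> real"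
  assumes f: "integrable lborel f" and k: "integrable lborel k"
    and k0: "\<And>z. 0 \<le> k z" and k1: "(LINT z|lborel. k z) = 1"
  shows "integrable lborel (\<lambda>x. LINT z|lborel. f (x + z) * k z)"
    and "cmod (fourier (\<lambda>x. LINT z|lborel. f (x + z) * k z) \<xi>) \<le> cmod (fourier f \<xi>)"
proof -
  have [measurable]: "f \<in> borel_measurable borel" "k \<in> borel_measurable borel"
    using borel_measurable_integrable[OF f] borel_measurable_integrable[OF k] by simp_all
  have trans: "(LINT x|lborel. \<bar>f (x + z)\<bar>) = (LINT x|lborel. \<bar>f x\<bar>)" for z
    using lborel_integral_affine_euclidean[of "\<lambda>x. \<bar>f x\<bar>" 1 z] by (simp add: add.commute)
  have ft: "integrable lborel (\<lambda>x. f (x + z))" for z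
    using f integrable_translate_iff[of f z] by (simp add: add.commute)
  have "integrable (lborel \<Otimes>\<^sub>M lborel) (\<lambda>(z, x). f (x + z) * k z)"
    by (intro lborel_pair.Fubini_integrable) (use ft k in \<open>simp_all add: abs_mult trans\<close>)
  from lborel_pair.integrable_product_swap[OF this]
  have prodint: "integrable (lborel \<Otimes>\<^sub>M lborel) (\<lambda>(x, z). f (x + z) * k z)"
    by simp
  show "integrable lborel (\<lambda>x. LINT z|lborel. f (x + z) * k z)"
    using lborel_pair.integrable_fst'[OF prodint] by simp
  have "fourier (\<lambda>x. LINT z|lborel. f (x + z) * k z) \<xi>
     = (LINT x|lborel. LINT z|lborel. complex_of_real (f (x + z) * k z) * cis (- (2 * pi * (\<xi> \<bullet> x))))"
    unfolding fourier_def by (simp only: integral_mult_left_zero integral_complex_of_real)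
  also have "\<dots> = (LINT z|lborel. LINT x|lborel. complex_of_real (f (x + z) * k z) * cis (- (2 * pi * (\<xi> \<bullet> x))))"
    by (rule lborel_pair.Fubini_integral[symmetric], rule Bochner_Integration.integrable_bound[OF prodint])
      (auto simp: norm_mult)
  also have "\<dots> = (LINT z|lborel. complex_of_real (k z) * cis (2 * pi * (\<xi> \<bullet> z)) * fourier f \<xi>)"
  proof (intro Bochner_Integration.integral_cong refl)
    fix z :: 'a
    have "(LINT x|lborel. complex_of_real (f (x + z) * k z) * cis (- (2 * pi * (\<xi> \<bullet> x))))
      = complex_of_real (k z) * fourier (\<lambda>x. f (x + z)) \<xi>"
      unfolding fourier_def integral_mult_right_zero[symmetric]
      by (intro Bochner_Integration.integral_cong refl) (simp only: of_real_mult mult_ac)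
    then show "(LINT x|lborel. complex_of_real (f (x + z) * k z) * cis (- (2 * pi * (\<xi> \<bullet> x))))
       = complex_of_real (k z) * cis (2 * pi * (\<xi> \<bullet> z)) * fourier f \<xi>"
      by (simp add: fourier_translate[OF f])
  qed
  also have "\<dots> = (LINT z|lborel. complex_of_real (k z) * cis (2 * pi * (\<xi> \<bullet> z))) * fourier f \<xi>"
    by (rule integral_mult_left_zero)
  finally have "cmod (fourier (\<lambda>x. LINT z|lborel. f (x + z) * k z) \<xi>)
      = cmod (LINT z|lborel. complex_of_real (k z) * cis (2 * pi * (\<xi> \<bullet> z))) * cmod (fourier f \<xi>)"
    by (simp add: norm_mult)
  moreover have "cmod (LINT z|lborel. complex_of_real (k z) * cis (2 * pi * (\<xi> \<bullet> z))) \<le> 1"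
    by (rule order_trans[OF integral_norm_bound]) (simp add: norm_mult k0 k1)
  ultimately show "cmod (fourier (\<lambda>x. LINT z|lborel. f (x + z) * k z) \<xi>) \<le> cmod (fourier f \<xi>)"
    by (simp add: mult_left_le_one_le)
qed

lemma diff_mem_box_iff:
  fixes w x a b :: "'a::euclidean_space"
  shows "w - x \<in> box a b \<longleftrightarrow> w \<in> box (x + a) (x + b)"
    and "w - x \<in> cbox a b \<longleftrightarrow> w \<in> cbox (x + a) (x + b)"
  unfolding mem_box inner_diff_left inner_add_left by (simp_all add: less_diff_eq diff_less_eq le_diff_eq diff_le_eq add.commute)

definition cube_kernel :: "real \<Rightarrow> 'a::euclidean_space \<Rightarrow> real" where
  "cube_kernel h z = indicator (cbox 0 (h *\<^sub>R One)) z / h ^ DIM('a)"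

definition cube_average :: "real \<Rightarrow> ('a::euclidean_space \<Rightarrow> real) \<Rightarrow> 'a \<Rightarrow> real" where
  "cube_average h f x = (LINT z|lborel. f (x + z) * cube_kernel h z)"

lemma cube_kernel_measurable [measurable]: "cube_kernel h \<in> borel_measurable borel"
  unfolding cube_kernel_def by measurable

lemma cube_kernel_integral:
  assumes h: "h > 0"
  shows "integrable lborel (cube_kernel h :: 'a::euclidean_space \<Rightarrow> real)"
    and "(LINT z|lborel. cube_kernel h (z::'a)) = 1"
proof -
  show "integrable lborel (cube_kernel h :: 'a \<Rightarrow> real)"
    unfolding cube_kernel_def
    using emeasure_bounded_finite[OF bounded_cbox, of 0 "h *\<^sub>R One :: 'a"]
    by (intro integrable_divide_zero integrable_real_indicator) auto
  have "measure lborel (cbox (0::'a) (h *\<^sub>R One)) = h ^ DIM('a)"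
    using h by (subst measure_lborel_cbox_eq) (auto simp: inner_sum_left_Basis)
  then show "(LINT z|lborel. cube_kernel h (z::'a)) = 1"
    unfolding cube_kernel_def using h by simp
qed

lemma cube_kernel_nonneg: "h > 0 \<Longrightarrow> 0 \<le> cube_kernel h z"
  and cube_kernel_le: "h > 0 \<Longrightarrow> cube_kernel h (z::'a::euclidean_space) \<le> 1 / h ^ DIM('a)"
  unfolding cube_kernel_def by (auto simp: indicator_def)

lemma cube_average_eq:
  fixes f :: "'a::euclidean_space \<Rightarrow> real"
  assumes [measurable]: "f \<in> borel_measurable borel"
  shows "cube_average h f x = (LINT w|lborel. f w * cube_kernel h (w - x))"
  unfolding cube_average_def
  by (subst lborel_integral_affine_euclidean[of "\<lambda>w. f w * cube_kernel h (w - x)" 1 x]) auto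

lemma cube_average_bounded:
  fixes f :: "'a::euclidean_space \<Rightarrow> real"
  assumes f: "integrable lborel f" and h: "h > 0"
  shows "\<bar>cube_average h f x\<bar> \<le> (LINT w|lborel. \<bar>f w\<bar>) / h ^ DIM('a)"
proof -
  have [measurable]: "f \<in> borel_measurable borel"
    using borel_measurable_integrable[OF f] by simp
  have le: "\<bar>f w * cube_kernel h (w - x)\<bar> \<le> \<bar>f w\<bar> / h ^ DIM('a)" for w
    using mult_left_mono[OF cube_kernel_le[OF h, of "w - x"], of "\<bar>f w\<bar>"] cube_kernel_nonneg[OF h, of "w - x"]
    by (simp add: abs_mult)
  have int: "integrable lborel (\<lambda>w. \<bar>f w\<bar> / h ^ DIM('a))"
    using f by simp
  have "\<bar>cube_average h f x\<bar> \<le> (LINT w|lborel. \<bar>f w\<bar> / h ^ DIM('a))"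
    unfolding cube_average_eq[OF \<open>f \<in> borel_measurable borel\<close>]
  proof (rule integral_abs_bound_integral)
    show "integrable lborel (\<lambda>w. f w * cube_kernel h (w - x))"
      by (rule Bochner_Integration.integrable_bound[OF int]) (use le h in auto)
  qed (use int le in auto)
  then show ?thesis by simp
qed

text \<open>The indicator of a cube is locally constant off the boundary of the cube, which is a null set; this
  is what makes cube averages of an integrable function continuous.\<close>

lemma cube_kernel_tendsto:
  fixes w :: "'a::euclidean_space"
  assumes X: "X \<longlonglongrightarrow> x" and w: "w - x \<in> box 0 (h *\<^sub>R One) \<or> w - x \<notin> cbox 0 (h *\<^sub>R One)"
  shows "(\<lambda>n. cube_kernel h (w - X n)) \<longlonglongrightarrow> cube_kernel h (w - x)"
proof (rule tendsto_eventually)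
  have lim: "(\<lambda>n. w - X n) \<longlonglongrightarrow> w - x" using X by (intro tendsto_intros)
  show "\<forall>\<^sub>F n in sequentially. cube_kernel h (w - X n) = cube_kernel h (w - x)"
    using w
  proof
    assume B: "w - x \<in> box 0 (h *\<^sub>R One)"
    have "\<forall>\<^sub>F n in sequentially. w - X n \<in> box 0 (h *\<^sub>R One)"
      by (rule topological_tendstoD[OF lim open_box B])
    moreover have "cube_kernel h z = 1 / h ^ DIM('a)" if "z \<in> box 0 (h *\<^sub>R One)" for z :: 'a
      using subsetD[OF box_subset_cbox that] by (simp add: cube_kernel_def)
    ultimately show ?thesis using B by (simp add: eventually_mono)
  next
    assume C: "w - x \<notin> cbox 0 (h *\<^sub>R One)"
    have "\<forall>\<^sub>F n in sequentially. w - X n \<in> - cbox 0 (h *\<^sub>R One)"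
      by (rule topological_tendstoD[OF lim]) (rule open_Compl closed_cbox | use C in blast)+
    moreover have "cube_kernel h z = 0" if "z \<in> - cbox 0 (h *\<^sub>R One)" for z :: 'a
      using that by (simp add: cube_kernel_def)
    ultimately show ?thesis using C by (simp add: eventually_mono)
  qed
qed

lemma cube_average_continuous:
  fixes f :: "'a::euclidean_space \<Rightarrow> real"
  assumes f: "integrable lborel f" and h: "h > 0"
  shows "continuous_on UNIV (cube_average h f)"
proof -
  have meas[measurable]: "f \<in> borel_measurable borel"
    using borel_measurable_integrable[OF f] by simp
  have "(\<lambda>n. cube_average h f (X n)) \<longlonglongrightarrow> cube_average h f x" if X: "X \<longlonglongrightarrow> x" for X and x :: 'a
    unfolding cube_average_eq[OF meas]
  proof (rule integral_dominated_convergence[where w="\<lambda>w. \<bar>f w\<bar> / h ^ DIM('a)"])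
    show "integrable lborel (\<lambda>w. \<bar>f w\<bar> / h ^ DIM('a))" using f by simp
    show "AE w in lborel. norm (f w * cube_kernel h (w - X i)) \<le> \<bar>f w\<bar> / h ^ DIM('a)" for i
    proof (intro AE_I2)
      fix w :: 'a
      show "norm (f w * cube_kernel h (w - X i)) \<le> \<bar>f w\<bar> / h ^ DIM('a)"
        using mult_left_mono[OF cube_kernel_le[OF h, of "w - X i"], of "\<bar>f w\<bar>"] cube_kernel_nonneg[OF h, of "w - X i"]
        by (simp add: abs_mult)
    qed
    have "negligible (cbox x (x + h *\<^sub>R One) - box x (x + h *\<^sub>R One))"
      by (rule negligible_frontier_interval)
    then have "AE w in lborel. w \<notin> cbox x (x + h *\<^sub>R One) - box x (x + h *\<^sub>R One)"
      unfolding negligible_iff_null_sets by (rule AE_completion_iff[THEN iffD1, OF AE_not_in])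
    then show "AE w in lborel. (\<lambda>n. f w * cube_kernel h (w - X n)) \<longlonglongrightarrow> f w * cube_kernel h (w - x)"
    proof (rule eventually_mono)
      fix w assume "w \<notin> cbox x (x + h *\<^sub>R One) - box x (x + h *\<^sub>R One)"
      then have "w - x \<in> box 0 (h *\<^sub>R One) \<or> w - x \<notin> cbox 0 (h *\<^sub>R One)"
        unfolding diff_mem_box_iff add_0_right by blast
      from tendsto_mult_left[OF cube_kernel_tendsto[OF X this]]
      show "(\<lambda>n. f w * cube_kernel h (w - X n)) \<longlonglongrightarrow> f w * cube_kernel h (w - x)" .
    qed
  next
    show "(\<lambda>w. f w * cube_kernel h (w - x)) \<in> borel_measurable lborel" by measurable
    show "(\<lambda>w. f w * cube_kernel h (w - X i)) \<in> borel_measurable lborel" for i by measurable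
  qed
  then show ?thesis
    unfolding continuous_on_sequentially o_def by blast
qed

text \<open>Lebesgue's differentiation theorem for cubes with \<open>x\<close> as a corner, which are the supports of the
  translated kernels.\<close>

lemma cube_average_tendsto:
  fixes f :: "'a::euclidean_space \<Rightarrow> real"
  assumes f: "integrable lborel f"
  shows "AE x in lborel. (\<lambda>n. cube_average (1 / real (Suc n)) f x) \<longlonglongrightarrow> f x"
proof -
  have [measurable]: "f \<in> borel_measurable borel"
    using borel_measurable_integrable[OF f] by simp
  have set: "set_integrable lborel S f" if "S \<in> sets borel" for S
    using integrable_mult_indicator[of S lborel f] f that by (simp add: set_integrable_def)
  have HK: "f integrable_on cbox a b" for a b
    by (rule set_borel_integral_eq_integral(1)) (simp add: set)
  obtain N where N: "negligible N"
    and conv: "\<And>x e. x \<notin> N \<Longrightarrow> 0 < e \<Longrightarrow> \<exists>d>0. \<forall>h. 0 < h \<and> h < d \<longrightarrow>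
        norm (integral (cbox x (x + h *\<^sub>R One)) f /\<^sub>R h ^ DIM('a) - f x) < e"
    using integrable_ccontinuous_explicit[OF HK] by metis
  have avg: "cube_average h f x = integral (cbox x (x + h *\<^sub>R One)) f /\<^sub>R h ^ DIM('a)" if "h > 0" for h x
  proof -
    have ind: "indicator (cbox 0 (h *\<^sub>R One)) (w - x) = (indicator (cbox x (x + h *\<^sub>R One)) w :: real)" for w
      by (simp add: indicator_def diff_mem_box_iff)
    have "cube_average h f x = (LINT w|lborel. indicator (cbox x (x + h *\<^sub>R One)) w *\<^sub>R f w) / h ^ DIM('a)"
      by (simp add: cube_average_eq cube_kernel_def ind mult.commute)
    also have "(LINT w|lborel. indicator (cbox x (x + h *\<^sub>R One)) w *\<^sub>R f w) = integral (cbox x (x + h *\<^sub>R One)) f"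
      using set_borel_integral_eq_integral(2)[OF set, of "cbox x (x + h *\<^sub>R One)"]
      by (simp add: set_lebesgue_integral_def)
    finally show ?thesis by (simp add: divide_inverse)
  qed
  have "AE x in lborel. x \<notin> N"
    using N unfolding negligible_iff_null_sets by (rule AE_completion_iff[THEN iffD1, OF AE_not_in])
  then show ?thesis
  proof (rule eventually_mono)
    fix x assume "x \<notin> N"
    show "(\<lambda>n. cube_average (1 / real (Suc n)) f x) \<longlonglongrightarrow> f x"
    proof (rule LIMSEQ_I)
      fix e :: real assume "e > 0"
      from conv[OF \<open>x \<notin> N\<close> this] obtain d where d: "d > 0"
        "\<And>h. 0 < h \<Longrightarrow> h < d \<Longrightarrow> norm (integral (cbox x (x + h *\<^sub>R One)) f /\<^sub>R h ^ DIM('a) - f x) < e" by blast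
      obtain m where m: "1 / real (Suc m) < d" using nat_approx_posE[OF d(1)] by blast
      have "norm (cube_average (1 / real (Suc n)) f x - f x) < e" if "n \<ge> m" for n
      proof -
        have "1 / real (Suc n) \<le> 1 / real (Suc m)" using that by (simp add: frac_le)
        then show ?thesis using d(2)[of "1 / real (Suc n)"] m by (simp add: avg)
      qed
      then show "\<exists>m. \<forall>n\<ge>m. norm (cube_average (1 / real (Suc n)) f x - f x) < e" by blast
    qed
  qed
qed

text \<open>The averages over cubes of side \<open>1 / (n + 1)\<close> satisfy the hypotheses of
  \<open>plancherel_le_continuous\<close>, their transforms are dominated by \<open>f^\<close>, and Fatou's lemma passes the bound to
  their limit \<open>f\<close>.\<close>

lemma plancherel_le:
  fixes f :: "'a::euclidean_space \<Rightarrow> real"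
  assumes f: "integrable lborel f"
  shows "(\<integral>\<^sup>+x. ennreal ((f x)\<^sup>2) \<partial>lborel) \<le> (\<integral>\<^sup>+\<xi>. ennreal ((cmod (fourier f \<xi>))\<^sup>2) \<partial>lborel)"
proof -
  have [measurable]: "f \<in> borel_measurable borel"
    using borel_measurable_integrable[OF f] by simp
  let ?h = "\<lambda>n. 1 / real (Suc n)"
  let ?g = "\<lambda>n. cube_average (?h n) f"
  have g_int: "integrable lborel (?g n)" for n
    unfolding cube_average_def
    by (rule averaging(1)[OF f]) (auto simp: cube_kernel_integral cube_kernel_nonneg)
  have [measurable]: "?g n \<in> borel_measurable borel" for n
    using borel_measurable_integrable[OF g_int] by simp
  have "(\<integral>\<^sup>+x. ennreal ((f x)\<^sup>2) \<partial>lborel) = (\<integral>\<^sup>+x. liminf (\<lambda>n. ennreal ((?g n x)\<^sup>2)) \<partial>lborel)"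
  proof (rule nn_integral_cong_AE)
    show "AE x in lborel. ennreal ((f x)\<^sup>2) = liminf (\<lambda>n. ennreal ((?g n x)\<^sup>2))"
      using cube_average_tendsto[OF f]
    proof (rule eventually_mono)
      fix x assume "(\<lambda>n. ?g n x) \<longlonglongrightarrow> f x"
      then have "(\<lambda>n. ennreal ((?g n x)\<^sup>2)) \<longlonglongrightarrow> ennreal ((f x)\<^sup>2)"
        by (intro tendsto_ennrealI tendsto_power)
      then show "ennreal ((f x)\<^sup>2) = liminf (\<lambda>n. ennreal ((?g n x)\<^sup>2))"
        by (rule lim_imp_Liminf[OF trivial_limit_sequentially, symmetric])
    qed
  qed
  also have "\<dots> \<le> liminf (\<lambda>n. \<integral>\<^sup>+x. ennreal ((?g n x)\<^sup>2) \<partial>lborel)"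
    by (rule nn_integral_liminf) measurable
  also have "\<dots> \<le> (\<integral>\<^sup>+\<xi>. ennreal ((cmod (fourier f \<xi>))\<^sup>2) \<partial>lborel)"
  proof (rule order_trans[OF Liminf_mono[where g="\<lambda>_. \<integral>\<^sup>+\<xi>. ennreal ((cmod (fourier f \<xi>))\<^sup>2) \<partial>lborel"]])
    show "\<forall>\<^sub>F n in sequentially. (\<integral>\<^sup>+x. ennreal ((?g n x)\<^sup>2) \<partial>lborel)
        \<le> (\<integral>\<^sup>+\<xi>. ennreal ((cmod (fourier f \<xi>))\<^sup>2) \<partial>lborel)"
    proof (intro always_eventually allI)
      fix n
      have "(\<integral>\<^sup>+x. ennreal ((?g n x)\<^sup>2) \<partial>lborel) \<le> (\<integral>\<^sup>+\<xi>. ennreal ((cmod (fourier (?g n) \<xi>))\<^sup>2) \<partial>lborel)"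
        by (rule plancherel_le_continuous[OF g_int cube_average_continuous[OF f] cube_average_bounded[OF f]]) simp_all
      also have "\<dots> \<le> (\<integral>\<^sup>+\<xi>. ennreal ((cmod (fourier f \<xi>))\<^sup>2) \<partial>lborel)"
        unfolding cube_average_def
        by (intro nn_integral_mono ennreal_leI power_mono averaging(2)[OF f])
           (auto simp: cube_kernel_integral cube_kernel_nonneg)
      finally show "(\<integral>\<^sup>+x. ennreal ((?g n x)\<^sup>2) \<partial>lborel) \<le> (\<integral>\<^sup>+\<xi>. ennreal ((cmod (fourier f \<xi>))\<^sup>2) \<partial>lborel)" .
    qed
  qed (simp add: Liminf_const)
  finally show ?thesis .
qed

section \<open>Energies of differences\<close>

text \<open>With \<open>y = x + z\<close> the left-hand side is \<open>\<integral> w z \<integral> (f (x + z) - f x)\<^sup>2 dx dz\<close>. The inner integral is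
  bounded by the Plancherel inequality, and exchanging the order of integration leaves the symbol of \<open>w\<close> as
  a weight on the frequency side.\<close>

lemma difference_energy_le:
  fixes f w :: "'a::euclidean_space \<Rightarrow> real"
  assumes f: "integrable lborel f" and [measurable]: "w \<in> borel_measurable borel"
    and w: "\<And>z. 0 \<le> w z"
  shows "(\<integral>\<^sup>+y. \<integral>\<^sup>+x. ennreal (w (y - x) * (f x - f y)\<^sup>2) \<partial>lborel \<partial>lborel)
    \<le> 2 * (\<integral>\<^sup>+\<xi>. (\<integral>\<^sup>+z. ennreal (w z * (1 - cos (2 * pi * (\<xi> \<bullet> z)))) \<partial>lborel) * ennreal ((cmod (fourier f \<xi>))\<^sup>2) \<partial>lborel)"
proof -
  have [measurable]: "f \<in> borel_measurable borel"
    using borel_measurable_integrable[OF f] by simp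
  have "(\<integral>\<^sup>+y. \<integral>\<^sup>+x. ennreal (w (y - x) * (f x - f y)\<^sup>2) \<partial>lborel \<partial>lborel)
     = (\<integral>\<^sup>+x. \<integral>\<^sup>+y. ennreal (w (y - x) * (f x - f y)\<^sup>2) \<partial>lborel \<partial>lborel)"
    by (rule lborel_pair.Fubini') measurable
  also have "\<dots> = (\<integral>\<^sup>+x. \<integral>\<^sup>+z. ennreal (w z * (f (x + z) - f x)\<^sup>2) \<partial>lborel \<partial>lborel)"
  proof (rule nn_integral_cong)
    fix x
    show "(\<integral>\<^sup>+y. ennreal (w (y - x) * (f x - f y)\<^sup>2) \<partial>lborel) = (\<integral>\<^sup>+z. ennreal (w z * (f (x + z) - f x)\<^sup>2) \<partial>lborel)"
      by (subst nn_integral_translate[of _ x, symmetric]) (auto simp: power2_commute)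
  qed
  also have "\<dots> = (\<integral>\<^sup>+z. \<integral>\<^sup>+x. ennreal (w z * (f (x + z) - f x)\<^sup>2) \<partial>lborel \<partial>lborel)"
    by (rule lborel_pair.Fubini') measurable
  also have "\<dots> = (\<integral>\<^sup>+z. ennreal (w z) * (\<integral>\<^sup>+x. ennreal ((f (x + z) - f x)\<^sup>2) \<partial>lborel) \<partial>lborel)"
    by (simp add: ennreal_mult w nn_integral_cmult)
  also have "\<dots> \<le> (\<integral>\<^sup>+z. ennreal (w z) * (\<integral>\<^sup>+\<xi>. ennreal ((cmod (fourier (\<lambda>x. f (x + z) - f x) \<xi>))\<^sup>2) \<partial>lborel) \<partial>lborel)"
  proof (rule nn_integral_mono, rule mult_left_mono, rule plancherel_le)
    show "integrable lborel (\<lambda>x. f (x + z) - f x)" for z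
      using f integrable_translate_iff[of f z] by (simp add: add.commute)
  qed simp
  also have "\<dots> = (\<integral>\<^sup>+z. \<integral>\<^sup>+\<xi>. 2 * (ennreal (w z * (1 - cos (2 * pi * (\<xi> \<bullet> z)))) * ennreal ((cmod (fourier f \<xi>))\<^sup>2)) \<partial>lborel \<partial>lborel)"
  proof (rule nn_integral_cong)
    fix z
    have "ennreal (w z) * ennreal ((cmod (fourier (\<lambda>x. f (x + z) - f x) \<xi>))\<^sup>2)
      = 2 * (ennreal (w z * (1 - cos (2 * pi * (\<xi> \<bullet> z)))) * ennreal ((cmod (fourier f \<xi>))\<^sup>2))" for \<xi>
    proof -
      have "ennreal (w z) * ennreal ((cmod (fourier (\<lambda>x. f (x + z) - f x) \<xi>))\<^sup>2)
        = ennreal (2 * (w z * (1 - cos (2 * pi * (\<xi> \<bullet> z))) * (cmod (fourier f \<xi>))\<^sup>2))"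
        unfolding fourier_difference[OF f] by (simp add: ennreal_mult'[symmetric] w mult_ac)
      also have "\<dots> = ennreal 2 * (ennreal (w z * (1 - cos (2 * pi * (\<xi> \<bullet> z)))) * ennreal ((cmod (fourier f \<xi>))\<^sup>2))"
      proof -
        have "ennreal (2 * (X * Y)) = ennreal 2 * (ennreal X * ennreal Y)" if "0 \<le> X" "0 \<le> Y" for X Y
          using that by (simp add: ennreal_mult)
        then show ?thesis using w[of z] by simp
      qed
      finally show ?thesis by simp
    qed
    then show "ennreal (w z) * (\<integral>\<^sup>+\<xi>. ennreal ((cmod (fourier (\<lambda>x. f (x + z) - f x) \<xi>))\<^sup>2) \<partial>lborel)
      = (\<integral>\<^sup>+\<xi>. 2 * (ennreal (w z * (1 - cos (2 * pi * (\<xi> \<bullet> z)))) * ennreal ((cmod (fourier f \<xi>))\<^sup>2)) \<partial>lborel)"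
      by (subst nn_integral_cmult[symmetric]) auto
  qed
  also have "\<dots> = (\<integral>\<^sup>+\<xi>. \<integral>\<^sup>+z. 2 * (ennreal (w z * (1 - cos (2 * pi * (\<xi> \<bullet> z)))) * ennreal ((cmod (fourier f \<xi>))\<^sup>2)) \<partial>lborel \<partial>lborel)"
    by (rule lborel_pair.Fubini') measurable
  also have "\<dots> = 2 * (\<integral>\<^sup>+\<xi>. (\<integral>\<^sup>+z. ennreal (w z * (1 - cos (2 * pi * (\<xi> \<bullet> z)))) \<partial>lborel) * ennreal ((cmod (fourier f \<xi>))\<^sup>2) \<partial>lborel)"
    by (simp add: nn_integral_cmult nn_integral_multc)
  finally show ?thesis .
qed

section \<open>Borel representatives\<close>

text \<open>The spaces are built on Lebesgue measurable functions, whereas Fubini's theorem is applied to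
  a product of Borel measures: \<open>\<omega>(\<bar>y - x\<bar>)\<close> with a Lebesgue measurable \<open>\<omega>\<close> need not be measurable for
  the product of the Lebesgue \<open>\<sigma>\<close>-algebras. All integrals are therefore moved to Borel functions that
  agree almost everywhere and vanish outside the domain.\<close>

lemma integral_lebesgue_on_eq_lborel:
  fixes h g :: "real^'n \<Rightarrow> 'b::euclidean_space"
  assumes \<Omega>: "\<Omega> \<in> sets borel" and g[measurable]: "g \<in> borel_measurable borel"
    and g0: "\<And>x. x \<notin> \<Omega> \<Longrightarrow> g x = 0" and ae: "AE x in lborel. x \<in> \<Omega> \<longrightarrow> h x = g x"
  shows "h \<in> borel_measurable (lebesgue_on \<Omega>)"
    and "(LINT x|lebesgue_on \<Omega>. h x) = (LINT x|lborel. g x)"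
    and "integrable (lebesgue_on \<Omega>) h \<longleftrightarrow> integrable lborel g"
proof -
  have \<Omega>': "\<Omega> \<inter> space lebesgue \<in> sets lebesgue" using \<Omega> by simp
  have gl: "g \<in> borel_measurable lebesgue" by (rule measurable_completion) simp
  have ae': "AE x in lebesgue. g x = indicator \<Omega> x *\<^sub>R h x"
    by (rule AE_completion, rule AE_mp[OF ae], rule AE_I2) (auto simp: g0 indicator_def)
  have hl: "(\<lambda>x. indicator \<Omega> x *\<^sub>R h x) \<in> borel_measurable lebesgue"
    by (rule borel_measurable_AE[OF gl ae'])
  show "h \<in> borel_measurable (lebesgue_on \<Omega>)"
    using hl by (simp add: borel_measurable_restrict_space_iff[OF \<Omega>'])
  show "(LINT x|lebesgue_on \<Omega>. h x) = (LINT x|lborel. g x)"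
    unfolding integral_restrict_space[OF \<Omega>'] using integral_cong_AE[OF gl hl ae']
    by (simp add: integral_completion)
  show "integrable (lebesgue_on \<Omega>) h \<longleftrightarrow> integrable lborel g"
    unfolding integrable_restrict_space[OF \<Omega>'] using integrable_cong_AE[OF gl hl ae']
    by (simp add: integrable_completion)
qed

text \<open>Here \<open>h\<close> is arbitrary, so that it may be the inner integral of an iterated one.\<close>

lemma nn_integral_lebesgue_on_eq_lborel:
  fixes h g :: "real^'n \<Rightarrow> ennreal"
  assumes \<Omega>: "\<Omega> \<in> sets borel"
    and g0: "\<And>x. x \<notin> \<Omega> \<Longrightarrow> g x = 0" and ae: "AE x in lborel. x \<in> \<Omega> \<longrightarrow> h x = g x"
  shows "(\<integral>\<^sup>+x. h x \<partial>lebesgue_on \<Omega>) = (\<integral>\<^sup>+x. g x \<partial>lborel)"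
proof -
  have \<Omega>': "\<Omega> \<inter> space lebesgue \<in> sets lebesgue" using \<Omega> by simp
  have "AE x in lborel. h x * indicator \<Omega> x = g x"
    by (rule AE_mp[OF ae], rule AE_I2) (auto simp: g0 indicator_def)
  then show ?thesis
    unfolding nn_integral_restrict_space[OF \<Omega>'] nn_integral_completion by (rule nn_integral_cong_AE)
qed

lemma AE_lborel_affine:
  fixes t :: "'a::euclidean_space"
  assumes ae: "AE z in lborel. P z" and c: "c \<noteq> 0"
  shows "AE z in lborel. P (t + c *\<^sub>R z)"
proof -
  obtain N where N: "{z \<in> space lborel. \<not> P z} \<subseteq> N" "emeasure lborel N = 0" "N \<in> sets lborel"
    using ae by (rule AE_E)
  have [measurable]: "N \<in> sets borel" using N(3) by simp
  have "AE z in lborel. z \<notin> N"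
    using N by (intro AE_not_in) auto
  then have "AE z in density (distr lborel borel (\<lambda>x. t + c *\<^sub>R x)) (\<lambda>_. ennreal (\<bar>c\<bar> ^ DIM('a))). z \<notin> N"
    unfolding lborel_affine[OF c, of t, symmetric] .
  then have "AE z in lborel. t + c *\<^sub>R z \<notin> N"
    using c by (simp add: AE_density AE_distr_iff)
  then show ?thesis
    by (rule eventually_mono) (use N(1) in auto)
qed

text \<open>The value \<open>0\<close> outside \<open>\<Omega>\<close> is the extension by zero on which the Fourier description of
  \<open>M_space\<close> is based.\<close>

definition borel_rep :: "(real^'n) set \<Rightarrow> (real^'n \<Rightarrow> 'b::euclidean_space) \<Rightarrow> (real^'n \<Rightarrow> 'b) \<Rightarrow> bool" where
  "borel_rep \<Omega> u f \<longleftrightarrow> f \<in> borel_measurable borel \<and> (\<forall>x. x \<notin> \<Omega> \<longrightarrow> f x = 0) \<and>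
     (AE x in lborel. x \<in> \<Omega> \<longrightarrow> u x = f x)"

text \<open>A Lebesgue measurable real function agrees almost everywhere with a Borel function; for vector
  values this is used in each coordinate.\<close>

lemma borel_rep_exists:
  fixes u :: "real^'n \<Rightarrow> 'b::euclidean_space"
  assumes \<Omega>[measurable]: "\<Omega> \<in> sets borel" and u: "u \<in> borel_measurable (lebesgue_on \<Omega>)"
  obtains f where "borel_rep \<Omega> u f"
proof -
  have \<Omega>': "\<Omega> \<inter> space lebesgue \<in> sets lebesgue" using \<Omega> by simp
  have "(\<lambda>x. indicator \<Omega> x *\<^sub>R u x) \<in> borel_measurable lebesgue"
    using u by (simp add: borel_measurable_restrict_space_iff[OF \<Omega>'])
  then have "(\<lambda>x. (indicator \<Omega> x *\<^sub>R u x) \<bullet> b) \<in> borel_measurable lebesgue" for b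
    by measurable
  then have "\<forall>b. \<exists>g \<in> borel_measurable lborel. AE x in lborel. (indicator \<Omega> x *\<^sub>R u x) \<bullet> b = g x"
    by (intro allI completion_ex_borel_measurable_real)
  then obtain g where g: "\<And>b. g b \<in> borel_measurable lborel"
      "\<And>b. AE x in lborel. (indicator \<Omega> x *\<^sub>R u x) \<bullet> b = g b x"
    by metis
  have [measurable]: "g b \<in> borel_measurable borel" for b using g(1)[of b] by simp
  define f where "f x = indicator \<Omega> x *\<^sub>R (\<Sum>b\<in>Basis. g b x *\<^sub>R b)" for x
  have "AE x in lborel. \<forall>b\<in>Basis. (indicator \<Omega> x *\<^sub>R u x) \<bullet> b = g b x"
    by (rule AE_finite_allI) (use g(2) in auto)
  then have "AE x in lborel. x \<in> \<Omega> \<longrightarrow> u x = f x"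
  proof (rule eventually_mono)
    fix x assume x: "\<forall>b\<in>Basis. (indicator \<Omega> x *\<^sub>R u x) \<bullet> b = g b x"
    show "x \<in> \<Omega> \<longrightarrow> u x = f x"
    proof
      assume "x \<in> \<Omega>"
      with x have "f x = (\<Sum>b\<in>Basis. (u x \<bullet> b) *\<^sub>R b)" by (simp add: f_def)
      then show "u x = f x" by (simp add: euclidean_representation)
    qed
  qed
  moreover have "f \<in> borel_measurable borel" unfolding f_def by measurable
  ultimately have "borel_rep \<Omega> u f" by (simp add: borel_rep_def f_def)
  then show ?thesis by (rule that)
qed

lemma borel_rep_diff_quot:
  assumes "borel_rep \<Omega> u f" "borel_rep \<Omega> v g"
  shows "borel_rep \<Omega> (diff_quot c u v) (diff_quot c f g)"
proof -
  have [measurable]: "f \<in> borel_measurable borel" "g \<in> borel_measurable borel"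
    using assms by (simp_all add: borel_rep_def)
  have "AE x in lborel. x \<in> \<Omega> \<longrightarrow> u x = f x" "AE x in lborel. x \<in> \<Omega> \<longrightarrow> v x = g x"
    using assms by (simp_all add: borel_rep_def)
  then have "AE x in lborel. x \<in> \<Omega> \<longrightarrow> diff_quot c u v x = diff_quot c f g x"
    by eventually_elim (simp add: diff_quot_def)
  moreover have "diff_quot c f g \<in> borel_measurable borel"
    unfolding diff_quot_def by measurable
  ultimately show ?thesis using assms by (auto simp: borel_rep_def diff_quot_def)
qed

lemma diff_quot_1: "diff_quot 1 p q = (\<lambda>x. p x - q x)"
  by (simp add: diff_quot_def fun_eq_iff)

lemma norm_scaled_diff_square_le:
  fixes a b :: "'a::real_normed_vector"
  shows "(norm (c *\<^sub>R (a - b)))\<^sup>2 \<le> 2 * c\<^sup>2 * ((norm a)\<^sup>2 + (norm b)\<^sup>2)"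
proof -
  have "(norm (a - b))\<^sup>2 \<le> (norm a + norm b)\<^sup>2"
    by (intro power_mono norm_triangle_ineq4) simp
  also have "\<dots> \<le> 2 * ((norm a)\<^sup>2 + (norm b)\<^sup>2)"
    using sum_squares_bound[of "norm a" "norm b"] by (simp add: power2_sum)
  finally have "c\<^sup>2 * (norm (a - b))\<^sup>2 \<le> c\<^sup>2 * (2 * ((norm a)\<^sup>2 + (norm b)\<^sup>2))"
    by (rule mult_left_mono) simp
  then show ?thesis by (simp only: norm_scaleR power_mult_distrib power2_abs mult_ac)
qed

lemma L2_iff_borel_rep:
  assumes \<Omega>: "\<Omega> \<in> sets borel" and rep: "borel_rep \<Omega> u f"
  shows "u \<in> L2 \<Omega> \<longleftrightarrow> integrable lborel (\<lambda>x. (norm (f x))\<^sup>2)"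
proof -
  have [measurable]: "f \<in> borel_measurable borel" and f0: "\<And>x. x \<notin> \<Omega> \<Longrightarrow> f x = 0"
    and ae: "AE x in lborel. x \<in> \<Omega> \<longrightarrow> u x = f x"
    using rep by (simp_all add: borel_rep_def)
  have "AE x in lborel. x \<in> \<Omega> \<longrightarrow> (norm (u x))\<^sup>2 = (norm (f x))\<^sup>2"
    using ae by eventually_elim simp
  then have "integrable (lebesgue_on \<Omega>) (\<lambda>x. (norm (u x))\<^sup>2) \<longleftrightarrow> integrable lborel (\<lambda>x. (norm (f x))\<^sup>2)"
    by (intro integral_lebesgue_on_eq_lborel(3)[OF \<Omega>]) (auto simp: f0)
  moreover have "u \<in> borel_measurable (lebesgue_on \<Omega>)"
    by (rule integral_lebesgue_on_eq_lborel(1)[OF \<Omega> _ _ ae]) (auto simp: f0)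
  ultimately show ?thesis by (simp add: L2_def)
qed

lemma L2_diff_quot:
  assumes "\<Omega> \<in> sets borel" "u \<in> L2 \<Omega>" "v \<in> L2 \<Omega>"
  shows "diff_quot c u v \<in> L2 \<Omega>"
proof -
  obtain f where f: "borel_rep \<Omega> u f" by (rule borel_rep_exists[of \<Omega> u]) (use assms in \<open>auto simp: L2_def\<close>)
  obtain g where g: "borel_rep \<Omega> v g" by (rule borel_rep_exists[of \<Omega> v]) (use assms in \<open>auto simp: L2_def\<close>)
  have [measurable]: "f \<in> borel_measurable borel" "g \<in> borel_measurable borel"
    using f g by (simp_all add: borel_rep_def)
  have "integrable lborel (\<lambda>x. 2 * (1/c)\<^sup>2 * ((norm (f x))\<^sup>2 + (norm (g x))\<^sup>2))"
    using assms L2_iff_borel_rep[OF _ f] L2_iff_borel_rep[OF _ g] by simp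
  then have "integrable lborel (\<lambda>x. (norm (diff_quot c f g x))\<^sup>2)"
  proof (rule Bochner_Integration.integrable_bound)
    show "(\<lambda>x. (norm (diff_quot c f g x))\<^sup>2) \<in> borel_measurable lborel"
      unfolding diff_quot_def by measurable
    show "AE x in lborel. norm ((norm (diff_quot c f g x))\<^sup>2)
        \<le> norm (2 * (1/c)\<^sup>2 * ((norm (f x))\<^sup>2 + (norm (g x))\<^sup>2))"
    proof (intro AE_I2)
      fix x
      show "norm ((norm (diff_quot c f g x))\<^sup>2) \<le> norm (2 * (1/c)\<^sup>2 * ((norm (f x))\<^sup>2 + (norm (g x))\<^sup>2))"
        using order_trans[OF norm_scaled_diff_square_le[of "1/c" "f x" "g x"] abs_ge_self]
        unfolding diff_quot_def real_norm_def abs_of_nonneg[OF zero_le_power2] .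
    qed
  qed
  then show ?thesis
    using L2_iff_borel_rep[OF assms(1) borel_rep_diff_quot[OF f g]] by blast
qed

section \<open>The kernel and its symbol\<close>

lemma one_minus_cos_le: "1 - cos t \<le> t\<^sup>2 / 2" for t :: real
proof -
  have "1 - cos t = 2 * (sin (t / 2))\<^sup>2"
    using cos_double_sin[of "t / 2"] by simp
  also have "(sin (t / 2))\<^sup>2 \<le> (t / 2)\<^sup>2"
    unfolding abs_le_square_iff[symmetric] by (rule abs_sin_x_le_abs_x)
  finally show ?thesis by (simp add: power_divide)
qed

text \<open>The moment condition is an equation whose right-hand side is not zero, so its integrand is
  integrable; the second moment is the trace of that integrand.\<close>

lemma admissible_kernel_second_moment:
  assumes k: "admissible_kernel TYPE('n::finite) \<delta> \<omega>"
  shows "integrable (lebesgue_on (ball (0::real^'n) \<delta>)) (\<lambda>x. \<omega> (norm x) * (norm x)\<^sup>2)"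
proof -
  let ?G = "\<lambda>x::real^'n. outer x (kernel_vec \<omega> 0 x)"
  have "(LINT x|lebesgue_on (ball (0::real^'n) \<delta>). ?G x) = mat 1"
    using k by (simp add: admissible_kernel_def)
  moreover have "(mat 1 :: real^'n^'n) \<noteq> 0"
  proof
    assume "(mat 1 :: real^'n^'n) = 0"
    then have "(mat 1 :: real^'n^'n) $ i $ i = 0" for i by simp
    then show False by (simp add: mat_def)
  qed
  ultimately have "integrable (lebesgue_on (ball (0::real^'n) \<delta>)) ?G"
    using not_integrable_integral_eq by metis
  then have "integrable (lebesgue_on (ball (0::real^'n) \<delta>)) (\<lambda>x. ?G x $ i $ i)" for i
    by (intro integrable_bounded_linear[OF bounded_linear_vec_nth])
  then have "integrable (lebesgue_on (ball (0::real^'n) \<delta>)) (\<lambda>x. \<Sum>i\<in>UNIV. ?G x $ i $ i)"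
    by (intro Bochner_Integration.integrable_sum)
  moreover have "(\<Sum>i\<in>UNIV. ?G x $ i $ i) = \<omega> (norm x) * (norm x)\<^sup>2" for x
    by (simp add: outer_def kernel_vec_def power2_norm_eq_inner inner_vec_def sum_distrib_left mult_ac)
  ultimately show ?thesis by simp
qed

text \<open>What the following results need to know about the kernel, expressed with a Borel version \<open>w\<close> of
  \<open>z \<mapsto> \<omega> (norm z)\<close>.\<close>

locale kernel_representative =
  fixes \<Omega> :: "(real^'n) set" and \<delta> :: real and \<omega> :: "real \<Rightarrow> real" and w :: "real^'n \<Rightarrow> real"
  assumes open_domain: "open \<Omega>" and bounded_domain: "bounded \<Omega>"
    and w_measurable [measurable]: "w \<in> borel_measurable borel"
    and w_nonneg: "0 \<le> w z"
    and w_eq: "AE z in lborel. \<omega> (norm z) = w z"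
    and symbol_integrable: "integrable lborel (\<lambda>z. w z * (1 - cos (2 * pi * (\<xi> \<bullet> z))))"
    and symbol_eq: "fourier_symbol \<delta> \<omega> \<xi> = (LINT z|lborel. w z * (1 - cos (2 * pi * (\<xi> \<bullet> z))))"

text \<open>The support condition makes the kernel vanish outside the closed ball. The values on the sphere are
  not restricted, but the sphere is a null set, so the Borel version may be taken to vanish there.\<close>

lemma kernel_borel_version:
  assumes k: "admissible_kernel TYPE('n::finite) \<delta> \<omega>" and \<delta>: "\<delta> > 0"
  obtains w :: "real^'n \<Rightarrow> real" where "w \<in> borel_measurable borel" "\<And>z. 0 \<le> w z"
    "\<And>z. z \<notin> ball 0 \<delta> \<Longrightarrow> w z = 0" "AE z in lborel. \<omega> (norm z) = w z"
proof -
  let ?B = "ball (0::real^'n) \<delta>"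
  have pos: "\<And>s. 0 \<le> s \<Longrightarrow> 0 \<le> \<omega> s" and meas: "(\<lambda>x::real^'n. \<omega> (norm x)) \<in> borel_measurable lebesgue"
    and supp: "closure {x::real^'n. \<omega> (norm x) \<noteq> 0} = closure ?B"
    using k by (simp_all only: admissible_kernel_def)
  obtain w' :: "real^'n \<Rightarrow> real" where w': "w' \<in> borel_measurable lborel" and ae': "AE z::real^'n in lborel. \<omega> (norm z) = w' z"
    using completion_ex_borel_measurable_real[OF meas] by blast
  define w where "w z = indicator ?B z * max 0 (w' z)" for z
  have "w \<in> borel_measurable borel"
    using w' unfolding w_def
    by (intro borel_measurable_times borel_measurable_indicator borel_measurable_max borel_measurable_const) simp_all
  moreover have w0: "0 \<le> w z" for z by (simp add: w_def)
  moreover have "AE z::real^'n in lborel. z \<notin> sphere 0 \<delta>"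
    using negligible_sphere[of "0::real^'n" \<delta>] unfolding negligible_iff_null_sets
    by (rule AE_completion_iff[THEN iffD1, OF AE_not_in])
  then have ae: "AE z in lborel. \<omega> (norm z) = w z"
    using ae'
  proof eventually_elim
    case (elim z)
    show ?case
    proof (cases "z \<in> ?B")
      case True
      then show ?thesis using elim pos[of "norm z"] by (simp add: w_def)
    next
      case False
      with elim(1) have "z \<notin> closure ?B" using \<delta> by (simp add: dist_norm)
      then have "z \<notin> {x::real^'n. \<omega> (norm x) \<noteq> 0}"
        using closure_subset[THEN subsetD] unfolding supp[symmetric] by metis
      then have "\<omega> (norm z) = 0" by simp
      then show ?thesis using False by (simp add: w_def)
    qed
  qed
  moreover have "w z = 0" if "z \<notin> ?B" for z using that by (simp add: w_def)
  ultimately show ?thesis using that by blast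
qed

text \<open>The bound \<open>1 - cos t \<le> t\<^sup>2 / 2\<close> compensates the singularity that the kernel may have at the
  origin.\<close>

lemma symbol_integrable_if_second_moment:
  fixes w :: "'a::euclidean_space \<Rightarrow> real"
  assumes [measurable]: "w \<in> borel_measurable borel" and w0: "\<And>z. 0 \<le> w z"
    and mom: "integrable lborel (\<lambda>z. w z * (norm z)\<^sup>2)"
  shows "integrable lborel (\<lambda>z. w z * (1 - cos (2 * pi * (\<xi> \<bullet> z))))"
proof (rule Bochner_Integration.integrable_bound)
  let ?K = "2 * pi\<^sup>2 * (norm \<xi>)\<^sup>2"
  show "integrable lborel (\<lambda>z. ?K * (w z * (norm z)\<^sup>2))" using mom by simp
  show "AE z in lborel. norm (w z * (1 - cos (2 * pi * (\<xi> \<bullet> z)))) \<le> norm (?K * (w z * (norm z)\<^sup>2))"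
  proof (intro AE_I2)
    fix z
    have "(\<xi> \<bullet> z)\<^sup>2 \<le> (norm \<xi>)\<^sup>2 * (norm z)\<^sup>2"
      using power_mono[OF Cauchy_Schwarz_ineq2[of \<xi> z] abs_ge_zero, of 2] by (simp add: power_mult_distrib)
    then have "2 * pi\<^sup>2 * (\<xi> \<bullet> z)\<^sup>2 \<le> ?K * (norm z)\<^sup>2"
      unfolding mult.assoc by (intro mult_left_mono) simp_all
    moreover have "(2 * pi * (\<xi> \<bullet> z))\<^sup>2 / 2 = 2 * pi\<^sup>2 * (\<xi> \<bullet> z)\<^sup>2"
      by (simp add: power_mult_distrib)
    ultimately have "1 - cos (2 * pi * (\<xi> \<bullet> z)) \<le> ?K * (norm z)\<^sup>2"
      using one_minus_cos_le[of "2 * pi * (\<xi> \<bullet> z)"] by linarith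
    from mult_left_mono[OF this w0[of z]]
    have "w z * (1 - cos (2 * pi * (\<xi> \<bullet> z))) \<le> ?K * (w z * (norm z)\<^sup>2)"
      by (simp only: mult_ac)
    moreover have "0 \<le> w z * (1 - cos (2 * pi * (\<xi> \<bullet> z)))"
      by (intro mult_nonneg_nonneg w0) simp
    ultimately show "norm (w z * (1 - cos (2 * pi * (\<xi> \<bullet> z)))) \<le> norm (?K * (w z * (norm z)\<^sup>2))"
      unfolding real_norm_def by linarith
  qed
qed measurable

lemma kernel_representative_exists:
  fixes \<Omega> :: "(real^'n) set"
  assumes k: "admissible_kernel TYPE('n) \<delta> \<omega>" and \<delta>: "\<delta> > 0" and \<Omega>: "open \<Omega>" "bounded \<Omega>"
  obtains w where "kernel_representative \<Omega> \<delta> \<omega> w"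
proof -
  let ?B = "ball (0::real^'n) \<delta>"
  obtain w :: "real^'n \<Rightarrow> real" where w[measurable]: "w \<in> borel_measurable borel" and w0: "\<And>z. 0 \<le> w z"
    and off: "\<And>z. z \<notin> ?B \<Longrightarrow> w z = 0" and ae: "AE z in lborel. \<omega> (norm z) = w z"
    by (rule kernel_borel_version[OF k \<delta>]) blast
  have "AE z in lborel. z \<in> ?B \<longrightarrow> \<omega> (norm z) * (norm z)\<^sup>2 = w z * (norm z)\<^sup>2"
    using ae by eventually_elim simp
  then have "integrable (lebesgue_on ?B) (\<lambda>z. \<omega> (norm z) * (norm z)\<^sup>2) \<longleftrightarrow> integrable lborel (\<lambda>z. w z * (norm z)\<^sup>2)"
    by (intro integral_lebesgue_on_eq_lborel(3)) (simp_all add: off)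
  then have int: "integrable lborel (\<lambda>z. w z * (1 - cos (2 * pi * (\<xi> \<bullet> z))))" for \<xi>
    using admissible_kernel_second_moment[OF k] by (intro symbol_integrable_if_second_moment[OF w w0]) simp
  have sym: "fourier_symbol \<delta> \<omega> \<xi> = (LINT z|lborel. w z * (1 - cos (2 * pi * (\<xi> \<bullet> z))))" for \<xi>
  proof -
    have "AE z in lborel. z \<in> ?B \<longrightarrow> \<omega> (norm z) * (1 - cos (2 * pi * (\<xi> \<bullet> z))) = w z * (1 - cos (2 * pi * (\<xi> \<bullet> z)))"
      using ae by eventually_elim simp
    then show ?thesis
      unfolding fourier_symbol_def
      by (intro integral_lebesgue_on_eq_lborel(2)) (simp_all add: off)
  qed
  show ?thesis
    by (rule that[OF kernel_representative.intro[OF \<Omega> w w0 ae int sym]])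
qed

section \<open>Function spaces and the nonlocal bilinear form\<close>

context kernel_representative
begin

lemma domain_borel [measurable, simp]: "\<Omega> \<in> sets borel"
  using open_domain by simp

lemma symbol_nonneg: "0 \<le> fourier_symbol \<delta> \<omega> (\<xi> :: real^'n)"
  unfolding symbol_eq by (intro integral_nonneg_AE AE_I2 mult_nonneg_nonneg w_nonneg) simp

lemma symbol_measurable [measurable]: "fourier_symbol \<delta> \<omega> \<in> borel_measurable (borel :: (real^'n) measure)"
  unfolding symbol_eq[abs_def] by measurable

text \<open>On a bounded domain square integrable functions are integrable, so that the transform of their
  extension by zero is given by an absolutely convergent integral.\<close>

lemma rep_integrable:
  fixes f :: "real^'n \<Rightarrow> real"
  assumes \<psi>: "\<psi> \<in> L2 \<Omega>" and f: "borel_rep \<Omega> \<psi> f"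
  shows "integrable lborel f"
proof (rule Bochner_Integration.integrable_bound)
  have "integrable lborel (indicator \<Omega> :: _ \<Rightarrow> real)"
    using emeasure_bounded_finite[OF bounded_domain] by (intro integrable_real_indicator) auto
  then show "integrable lborel (\<lambda>x. indicator \<Omega> x + (norm (f x))\<^sup>2 :: real)"
    using \<psi> L2_iff_borel_rep[OF _ f] by simp
  show "f \<in> borel_measurable lborel" using f by (simp add: borel_rep_def)
  have "\<bar>a\<bar> \<le> 1 + a\<^sup>2" for a :: real
  proof -
    have "(\<bar>a\<bar> - 1)\<^sup>2 = a\<^sup>2 - 2 * \<bar>a\<bar> + 1" by (simp add: power2_diff)
    then show ?thesis using zero_le_power2[of "\<bar>a\<bar> - 1"] abs_ge_zero[of a] by linarith
  qed
  then show "AE x in lborel. norm (f x) \<le> norm (indicator \<Omega> x + (norm (f x))\<^sup>2 :: real)"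
    using f by (intro AE_I2) (auto simp: borel_rep_def indicator_def)
qed

lemma fourier_ext_rep:
  assumes f: "borel_rep \<Omega> \<psi> f"
  shows "fourier_ext \<Omega> \<psi> \<xi> = fourier f \<xi>"
proof -
  have [measurable]: "f \<in> borel_measurable borel" and f0: "\<And>x. x \<notin> \<Omega> \<Longrightarrow> f x = 0"
    and ae: "AE x in lborel. x \<in> \<Omega> \<longrightarrow> \<psi> x = f x"
    using f by (simp_all add: borel_rep_def)
  have "AE x in lborel. x \<in> \<Omega> \<longrightarrow> complex_of_real (\<psi> x) * cis (- (2 * pi * (\<xi> \<bullet> x)))
      = complex_of_real (f x) * cis (- (2 * pi * (\<xi> \<bullet> x)))"
    using ae by eventually_elim simp
  then show ?thesis
    unfolding fourier_ext_def fourier_def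
    by (intro integral_lebesgue_on_eq_lborel(2)) (auto simp: f0)
qed

lemma M_space_iff_rep:
  assumes f: "borel_rep \<Omega> \<psi> f" and \<psi>: "\<psi> \<in> L2 \<Omega>"
  shows "\<psi> \<in> M_space \<Omega> \<delta> \<omega> \<longleftrightarrow>
    (\<integral>\<^sup>+\<xi>. ennreal ((1 + fourier_symbol \<delta> \<omega> \<xi>) * (cmod (fourier f \<xi>))\<^sup>2) \<partial>lborel) < \<infinity>"
  using \<psi> by (simp add: M_space_def fourier_ext_rep[OF f] nn_integral_completion)

lemma M_space_diff_quot:
  assumes \<psi>: "\<psi> \<in> M_space \<Omega> \<delta> \<omega>" and \<phi>: "\<phi> \<in> M_space \<Omega> \<delta> \<omega>"
  shows "diff_quot c \<psi> \<phi> \<in> M_space \<Omega> \<delta> \<omega>"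
proof -
  have L2: "\<psi> \<in> L2 \<Omega>" "\<phi> \<in> L2 \<Omega>" using assms by (simp_all add: M_space_def)
  obtain f where f: "borel_rep \<Omega> \<psi> f" by (rule borel_rep_exists[of \<Omega> \<psi>]) (use L2 in \<open>auto simp: L2_def\<close>)
  obtain g where g: "borel_rep \<Omega> \<phi> g" by (rule borel_rep_exists[of \<Omega> \<phi>]) (use L2 in \<open>auto simp: L2_def\<close>)
  have [measurable]: "f \<in> borel_measurable borel" "g \<in> borel_measurable borel"
    using f g by (simp_all add: borel_rep_def)
  let ?m = "\<lambda>\<xi>. 1 + fourier_symbol \<delta> \<omega> \<xi>"
  have m0: "0 \<le> ?m \<xi>" for \<xi> :: "real^'n" using symbol_nonneg[of \<xi>] by simp
  have eq: "fourier (diff_quot c f g) \<xi> = (1/c) *\<^sub>R (fourier f \<xi> - fourier g \<xi>)" for \<xi> :: "real^'n"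
  proof -
    have "fourier (diff_quot c f g) \<xi> = (LINT x|lborel. (1/c) *\<^sub>R (complex_of_real (f x) * cis (- (2 * pi * (\<xi> \<bullet> x)))
        - complex_of_real (g x) * cis (- (2 * pi * (\<xi> \<bullet> x)))))"
      unfolding fourier_def diff_quot_def
      by (intro Bochner_Integration.integral_cong refl) (simp add: scaleR_conv_of_real left_diff_distrib right_diff_distrib)
    also have "\<dots> = (1/c) *\<^sub>R (fourier f \<xi> - fourier g \<xi>)"
      unfolding fourier_def integral_scaleR_right
      by (subst Bochner_Integration.integral_diff) (use fourier_integrand_integrable rep_integrable L2 f g in auto)
    finally show ?thesis .
  qed
  have le: "?m \<xi> * (cmod (fourier (diff_quot c f g) \<xi>))\<^sup>2
      \<le> 2 * (1/c)\<^sup>2 * (?m \<xi> * (cmod (fourier f \<xi>))\<^sup>2 + ?m \<xi> * (cmod (fourier g \<xi>))\<^sup>2)" for \<xi> :: "real^'n"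
  proof -
    have "m * (k * (F + G)) = k * (m * F + m * G)" for m k F G :: real by (simp add: algebra_simps)
    then show ?thesis
      using mult_left_mono[OF norm_scaled_diff_square_le[of "1/c" "fourier f \<xi>" "fourier g \<xi>"] m0[of \<xi>]]
      unfolding eq by (simp only:)
  qed
  have "(\<integral>\<^sup>+\<xi>. ennreal (?m \<xi> * (cmod (fourier (diff_quot c f g) \<xi>))\<^sup>2) \<partial>lborel)
      \<le> (\<integral>\<^sup>+\<xi>. ennreal (2 * (1/c)\<^sup>2) * (ennreal (?m \<xi> * (cmod (fourier f \<xi>))\<^sup>2) + ennreal (?m \<xi> * (cmod (fourier g \<xi>))\<^sup>2)) \<partial>lborel)"
  proof (rule nn_integral_mono)
    fix \<xi> :: "real^'n"
    show "ennreal (?m \<xi> * (cmod (fourier (diff_quot c f g) \<xi>))\<^sup>2)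
      \<le> ennreal (2 * (1/c)\<^sup>2) * (ennreal (?m \<xi> * (cmod (fourier f \<xi>))\<^sup>2) + ennreal (?m \<xi> * (cmod (fourier g \<xi>))\<^sup>2))"
      using ennreal_leI[OF le[of \<xi>]] m0[of \<xi>]
      by (simp add: ennreal_mult ennreal_plus del: ennreal_le_iff)
  qed
  also have "\<dots> = ennreal (2 * (1/c)\<^sup>2) * ((\<integral>\<^sup>+\<xi>. ennreal (?m \<xi> * (cmod (fourier f \<xi>))\<^sup>2) \<partial>lborel)
      + (\<integral>\<^sup>+\<xi>. ennreal (?m \<xi> * (cmod (fourier g \<xi>))\<^sup>2) \<partial>lborel))"
    by (simp add: nn_integral_cmult nn_integral_add)
  also have "\<dots> < \<infinity>"
    using M_space_iff_rep[OF f L2(1)] M_space_iff_rep[OF g L2(2)] assms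
    by (auto simp: ennreal_mult_less_top)
  finally show ?thesis
    using M_space_iff_rep[OF borel_rep_diff_quot[OF f g] L2_diff_quot[OF _ L2]] by simp
qed

text \<open>The kernel of the double integrals over \<open>\<Omega> \<times> \<Omega>\<close>. The outer variable \<open>y\<close> comes first, as in
  \<open>crack_form\<close>.\<close>

definition weight :: "(real^'n) \<times> (real^'n) \<Rightarrow> real" where
  "weight = (\<lambda>(y, x). indicator \<Omega> x * indicator \<Omega> y * w (y - x))"

lemma weight_measurable [measurable]: "weight \<in> borel_measurable (borel \<Otimes>\<^sub>M borel)"
  unfolding weight_def by measurable

lemma weight_nonneg: "0 \<le> weight p"
  by (simp add: weight_def split_beta w_nonneg)

lemma weight_off: "y \<notin> \<Omega> \<Longrightarrow> weight (y, x) = 0" "x \<notin> \<Omega> \<Longrightarrow> weight (y, x) = 0"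
  by (simp_all add: weight_def)

lemma w_eq_left: "AE y in lborel. \<omega> (norm (y - x)) = w (y - x)"
  using AE_lborel_affine[OF w_eq, of 1 "- x"] by simp

lemma w_eq_right: "AE x in lborel. \<omega> (norm (y - x)) = w (y - x)"
  using AE_lborel_affine[OF w_eq, of "-1" y] by simp

text \<open>The step from the Fourier description of the space to the finiteness of the nonlocal energy: the
  latter is at most twice the integral of \<open>m\<^sub>\<omega> \<bar>\<psi>^\<bar>\<^sup>2\<close>.\<close>

lemma M_space_energy:
  assumes f: "borel_rep \<Omega> \<psi> f" and \<psi>: "\<psi> \<in> M_space \<Omega> \<delta> \<omega>"
  shows "integrable (lborel \<Otimes>\<^sub>M lborel) (\<lambda>(y, x). weight (y, x) * (f x - f y) * (f x - f y))"
proof -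
  have [measurable]: "f \<in> borel_measurable borel"
    using f by (simp_all add: borel_rep_def)
  have L2: "\<psi> \<in> L2 \<Omega>" using \<psi> by (simp add: M_space_def)
  have fi: "integrable lborel f" by (rule rep_integrable[OF L2 f])
  have "(\<integral>\<^sup>+y. \<integral>\<^sup>+x. ennreal (w (y - x) * (f x - f y)\<^sup>2) \<partial>lborel \<partial>lborel)
     \<le> 2 * (\<integral>\<^sup>+\<xi>. (\<integral>\<^sup>+z. ennreal (w z * (1 - cos (2 * pi * (\<xi> \<bullet> z)))) \<partial>lborel) * ennreal ((cmod (fourier f \<xi>))\<^sup>2) \<partial>lborel)"
    by (rule difference_energy_le[OF fi w_measurable w_nonneg])
  also have "\<dots> = 2 * (\<integral>\<^sup>+\<xi>. ennreal (fourier_symbol \<delta> \<omega> \<xi>) * ennreal ((cmod (fourier f \<xi>))\<^sup>2) \<partial>lborel)"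
    unfolding symbol_eq
    by (subst nn_integral_eq_integral[OF symbol_integrable]) (simp_all add: w_nonneg)
  also have "\<dots> \<le> 2 * (\<integral>\<^sup>+\<xi>. ennreal ((1 + fourier_symbol \<delta> \<omega> \<xi>) * (cmod (fourier f \<xi>))\<^sup>2) \<partial>lborel)"
  proof (rule mult_left_mono[OF nn_integral_mono])
    fix \<xi>
    show "ennreal (fourier_symbol \<delta> \<omega> \<xi>) * ennreal ((cmod (fourier f \<xi>))\<^sup>2)
        \<le> ennreal ((1 + fourier_symbol \<delta> \<omega> \<xi>) * (cmod (fourier f \<xi>))\<^sup>2)"
      unfolding ennreal_mult[OF symbol_nonneg zero_le_power2, symmetric]
      by (rule ennreal_leI) (simp add: distrib_right)
  qed simp
  also have "\<dots> < \<infinity>"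
    using M_space_iff_rep[OF f L2] \<psi> by (auto simp: ennreal_mult_less_top)
  finally have fin: "(\<integral>\<^sup>+y. \<integral>\<^sup>+x. ennreal (w (y - x) * (f x - f y)\<^sup>2) \<partial>lborel \<partial>lborel) < \<infinity>" .
  have "(\<integral>\<^sup>+p. ennreal (case p of (y, x) \<Rightarrow> weight (y, x) * (f x - f y) * (f x - f y)) \<partial>(lborel \<Otimes>\<^sub>M lborel))
    = (\<integral>\<^sup>+y. \<integral>\<^sup>+x. ennreal (weight (y, x) * (f x - f y) * (f x - f y)) \<partial>lborel \<partial>lborel)"
    by (subst lborel.nn_integral_fst[symmetric]) simp_all
  also have "\<dots> \<le> (\<integral>\<^sup>+y. \<integral>\<^sup>+x. ennreal (w (y - x) * (f x - f y)\<^sup>2) \<partial>lborel \<partial>lborel)"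
    by (intro nn_integral_mono ennreal_leI)
       (auto simp: weight_def indicator_def power2_eq_square mult.assoc w_nonneg)
  also note fin
  finally show ?thesis
    by (intro integrableI_nonneg) (auto simp: weight_nonneg mult.assoc intro!: AE_I2)
qed

lemma M_space_energy_mixed:
  assumes f: "borel_rep \<Omega> \<psi> f" and \<psi>: "\<psi> \<in> M_space \<Omega> \<delta> \<omega>"
    and g: "borel_rep \<Omega> \<phi> g" and \<phi>: "\<phi> \<in> M_space \<Omega> \<delta> \<omega>"
  shows "integrable (lborel \<Otimes>\<^sub>M lborel) (\<lambda>(y, x). weight (y, x) * (f x - f y) * (g x - g y))"
proof (rule Bochner_Integration.integrable_bound)
  have [measurable]: "f \<in> borel_measurable borel" "g \<in> borel_measurable borel"
    using f g by (simp_all add: borel_rep_def)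
  show "integrable (lborel \<Otimes>\<^sub>M lborel) (\<lambda>p. (case p of (y, x) \<Rightarrow> weight (y, x) * (f x - f y) * (f x - f y))
      + (case p of (y, x) \<Rightarrow> weight (y, x) * (g x - g y) * (g x - g y)))"
    by (intro Bochner_Integration.integrable_add M_space_energy[OF f \<psi>] M_space_energy[OF g \<phi>])
  show "(\<lambda>(y, x). weight (y, x) * (f x - f y) * (g x - g y)) \<in> borel_measurable (lborel \<Otimes>\<^sub>M lborel)"
    by measurable
  have "\<bar>k * a * b\<bar> \<le> \<bar>k * a * a + k * b * b\<bar>" if "0 \<le> k" for k a b :: real
  proof -
    have "\<bar>a * b\<bar> \<le> a * a + b * b"
    proof -
      have "2 * \<bar>a * b\<bar> \<le> a * a + b * b"
        using sum_squares_bound[of "\<bar>a\<bar>" "\<bar>b\<bar>"] by (simp add: abs_mult power2_eq_square mult.assoc)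
      then show ?thesis using abs_ge_zero[of "a * b"] by linarith
    qed
    from mult_left_mono[OF this that] show ?thesis
      using that by (simp add: abs_mult algebra_simps)
  qed
  from this[OF weight_nonneg]
  show "AE p in lborel \<Otimes>\<^sub>M lborel. norm (case p of (y, x) \<Rightarrow> weight (y, x) * (f x - f y) * (g x - g y))
    \<le> norm ((case p of (y, x) \<Rightarrow> weight (y, x) * (f x - f y) * (f x - f y))
      + (case p of (y, x) \<Rightarrow> weight (y, x) * (g x - g y) * (g x - g y)))"
    by (intro AE_I2) (simp add: split_beta)
qed

text \<open>For almost every \<open>y\<close> the inner integrands agree for almost every \<open>x\<close>, which suffices for the iterated
  integral; by \<open>M_space_energy_mixed\<close> this is then an integral over the product space, and hence additive in
  each argument.\<close>

lemma crack_form_rep: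
  assumes f: "borel_rep \<Omega> \<psi> f" and \<psi>: "\<psi> \<in> M_space \<Omega> \<delta> \<omega>"
    and g: "borel_rep \<Omega> \<phi> g" and \<phi>: "\<phi> \<in> M_space \<Omega> \<delta> \<omega>"
  shows "crack_form \<Omega> \<delta> \<omega> \<psi> \<phi> = 1 / \<delta> * (LINT x|lborel. f x * g x)
     + \<delta> / 2 * (LINT p|(lborel \<Otimes>\<^sub>M lborel). weight p * (f (snd p) - f (fst p)) * (g (snd p) - g (fst p)))"
proof -
  have [measurable]: "f \<in> borel_measurable borel" "g \<in> borel_measurable borel"
    and f0: "\<And>x. x \<notin> \<Omega> \<Longrightarrow> f x = 0"
    and aef: "AE x in lborel. x \<in> \<Omega> \<longrightarrow> \<psi> x = f x"
    and aeg: "AE x in lborel. x \<in> \<Omega> \<longrightarrow> \<phi> x = g x"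
    using f g by (simp_all add: borel_rep_def)
  have "AE x in lborel. x \<in> \<Omega> \<longrightarrow> \<psi> x * \<phi> x = f x * g x"
    using aef aeg by eventually_elim simp
  then have single: "(LINT x|lebesgue_on \<Omega>. \<psi> x * \<phi> x) = (LINT x|lborel. f x * g x)"
    by (intro integral_lebesgue_on_eq_lborel(2)) (auto simp: f0)
  have inner: "(LINT x|lebesgue_on \<Omega>. \<omega> (norm (y - x)) * (\<psi> x - \<psi> y) * (\<phi> x - \<phi> y))
      = (LINT x|lborel. weight (y, x) * (f x - f y) * (g x - g y))"
    if y: "y \<in> \<Omega>" "\<psi> y = f y" "\<phi> y = g y" for y
  proof -
    have "AE x in lborel. x \<in> \<Omega> \<longrightarrow> \<omega> (norm (y - x)) * (\<psi> x - \<psi> y) * (\<phi> x - \<phi> y)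
        = weight (y, x) * (f x - f y) * (g x - g y)"
      using aef aeg w_eq_right[of y] by eventually_elim (use y in \<open>simp add: weight_def\<close>)
    then show ?thesis
      by (intro integral_lebesgue_on_eq_lborel(2)) (auto simp: weight_off)
  qed
  have "AE y in lborel. y \<in> \<Omega> \<longrightarrow>
      (LINT x|lebesgue_on \<Omega>. \<omega> (norm (y - x)) * (\<psi> x - \<psi> y) * (\<phi> x - \<phi> y))
      = (LINT x|lborel. weight (y, x) * (f x - f y) * (g x - g y))"
    using aef aeg by eventually_elim (use inner in blast)
  then have "(LINT y|lebesgue_on \<Omega>. LINT x|lebesgue_on \<Omega>. \<omega> (norm (y - x)) * (\<psi> x - \<psi> y) * (\<phi> x - \<phi> y))
      = (LINT y|lborel. LINT x|lborel. weight (y, x) * (f x - f y) * (g x - g y))"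
    by (intro integral_lebesgue_on_eq_lborel(2)) (auto simp: weight_off)
  also have "\<dots> = (LINT p|(lborel \<Otimes>\<^sub>M lborel). (case p of (y, x) \<Rightarrow> weight (y, x) * (f x - f y) * (g x - g y)))"
    using lborel_pair.integral_fst'[OF M_space_energy_mixed[OF f \<psi> g \<phi>]] by simp
  also have "\<dots> = (LINT p|(lborel \<Otimes>\<^sub>M lborel). weight p * (f (snd p) - f (fst p)) * (g (snd p) - g (fst p)))"
    by (simp add: case_prod_beta')
  finally show ?thesis
    by (simp add: crack_form_def single)
qed

end

section \<open>Polarization and test spaces\<close>

text \<open>The identity \<open>2 P (P - Q) = P\<^sup>2 - Q\<^sup>2 + (P - Q)\<^sup>2\<close> under an integral with a weight. It serves both
  the local and the nonlocal part of \<open>crack_form\<close>.\<close>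

lemma weighted_polarization:
  fixes k P Q :: "'a \<Rightarrow> real"
  assumes "integrable M (\<lambda>x. k x * P x * P x)" "integrable M (\<lambda>x. k x * Q x * Q x)"
    "integrable M (\<lambda>x. k x * (P x - Q x) * (P x - Q x))"
  shows "(LINT x|M. k x * P x * (c * (P x - Q x))) = c / 2 * ((LINT x|M. k x * P x * P x)
    - (LINT x|M. k x * Q x * Q x) + (LINT x|M. k x * (P x - Q x) * (P x - Q x)))"
proof -
  have "(LINT x|M. k x * P x * (c * (P x - Q x)))
    = (LINT x|M. c / 2 * (k x * P x * P x - k x * Q x * Q x + k x * (P x - Q x) * (P x - Q x)))"
    by (intro Bochner_Integration.integral_cong refl) (simp add: field_simps)
  then show ?thesis using assms by simp
qed

context kernel_representative
begin

text \<open>Testing the implicit phase-field equation with the discrete time derivative thus yields an exact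
  increment of the crack energy plus a numerical dissipation.\<close>

lemma crack_form_polarization:
  assumes \<psi>: "\<psi> \<in> M_space \<Omega> \<delta> \<omega>" and \<phi>: "\<phi> \<in> M_space \<Omega> \<delta> \<omega>"
  shows "crack_form \<Omega> \<delta> \<omega> \<psi> (diff_quot c \<psi> \<phi>) = 1 / (2 * c) * (crack_form \<Omega> \<delta> \<omega> \<psi> \<psi>
    - crack_form \<Omega> \<delta> \<omega> \<phi> \<phi> + crack_form \<Omega> \<delta> \<omega> (\<lambda>x. \<psi> x - \<phi> x) (\<lambda>x. \<psi> x - \<phi> x))"
proof -
  have L2: "\<psi> \<in> L2 \<Omega>" "\<phi> \<in> L2 \<Omega>" using assms by (simp_all add: M_space_def)
  obtain f where f: "borel_rep \<Omega> \<psi> f" by (rule borel_rep_exists[of \<Omega> \<psi>]) (use L2 in \<open>auto simp: L2_def\<close>)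
  obtain g where g: "borel_rep \<Omega> \<phi> g" by (rule borel_rep_exists[of \<Omega> \<phi>]) (use L2 in \<open>auto simp: L2_def\<close>)
  have d: "borel_rep \<Omega> (\<lambda>x. \<psi> x - \<phi> x) (\<lambda>x. f x - g x)"
    using borel_rep_diff_quot[OF f g, of 1] by (simp add: diff_quot_1)
  have dM: "(\<lambda>x. \<psi> x - \<phi> x) \<in> M_space \<Omega> \<delta> \<omega>"
    using M_space_diff_quot[OF \<psi> \<phi>, of 1] by (simp add: diff_quot_1)
  let ?D = "\<lambda>h p. h (snd p) - h (fst p) :: real"
  have sq: "integrable lborel (\<lambda>x. 1 * h x * h x)" if "borel_rep \<Omega> \<zeta> h" "\<zeta> \<in> M_space \<Omega> \<delta> \<omega>" for \<zeta> h
    using that L2_iff_borel_rep[OF _ that(1)] by (simp add: M_space_def power2_eq_square)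
  have en: "integrable (lborel \<Otimes>\<^sub>M lborel) (\<lambda>p. weight p * ?D h p * ?D h p)"
    if "borel_rep \<Omega> \<zeta> h" "\<zeta> \<in> M_space \<Omega> \<delta> \<omega>" for \<zeta> h
    using M_space_energy[OF that] by (simp add: case_prod_beta')
  have s: "(LINT x|lborel. f x * diff_quot c f g x) = 1 / c / 2 * ((LINT x|lborel. f x * f x)
      - (LINT x|lborel. g x * g x) + (LINT x|lborel. (f x - g x) * (f x - g x)))"
    using weighted_polarization[OF sq[OF f \<psi>] sq[OF g \<phi>] sq[OF d dM], of "1 / c"]
    by (simp add: diff_quot_def)
  have dd: "?D f p - ?D g p = ?D (\<lambda>x. f x - g x) p" for p by simp
  have qd: "?D (diff_quot c f g) p = 1 / c * (?D f p - ?D g p)" for p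
    by (simp add: diff_quot_def right_diff_distrib diff_divide_distrib)
  have e: "(LINT p|(lborel \<Otimes>\<^sub>M lborel). weight p * ?D f p * ?D (diff_quot c f g) p)
    = 1 / c / 2 * ((LINT p|(lborel \<Otimes>\<^sub>M lborel). weight p * ?D f p * ?D f p)
      - (LINT p|(lborel \<Otimes>\<^sub>M lborel). weight p * ?D g p * ?D g p)
      + (LINT p|(lborel \<Otimes>\<^sub>M lborel). weight p * ?D (\<lambda>x. f x - g x) p * ?D (\<lambda>x. f x - g x) p))"
    unfolding qd using weighted_polarization[OF en[OF f \<psi>] en[OF g \<phi>], of "1 / c"] en[OF d dM]
    unfolding dd by blast
  have alg: "1 / \<delta> * (1 / c / 2 * (a - a' + a'')) + \<delta> / 2 * (1 / c / 2 * (b - b' + b''))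
    = 1 / (2 * c) * ((1 / \<delta> * a + \<delta> / 2 * b) - (1 / \<delta> * a' + \<delta> / 2 * b') + (1 / \<delta> * a'' + \<delta> / 2 * b''))"
    for a a' a'' b b' b'' :: real
  proof -
    have "1 / c / 2 = 1 / (2 * c)" by simp
    then show ?thesis by (simp only: ring_distribs mult_ac)
  qed
  show ?thesis
    unfolding crack_form_rep[OF f \<psi> borel_rep_diff_quot[OF f g] M_space_diff_quot[OF \<psi> \<phi>]]
      crack_form_rep[OF f \<psi> f \<psi>] crack_form_rep[OF g \<phi> g \<phi>] crack_form_rep[OF d dM d dM] s e
    by (rule alg)
qed

lemma V_space_iff_rep:
  fixes u :: "real^'n \<Rightarrow> real^'n"
  assumes f: "borel_rep \<Omega> u f" and u: "u \<in> L2 \<Omega>"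
  shows "u \<in> V_space \<Omega> \<omega> \<longleftrightarrow>
    (\<integral>\<^sup>+x. \<integral>\<^sup>+y. ennreal ((norm (f y - f x))\<^sup>2 * weight (y, x)) \<partial>lborel \<partial>lborel) < \<infinity>"
proof -
  have [measurable]: "f \<in> borel_measurable borel"
    and ae: "AE x in lborel. x \<in> \<Omega> \<longrightarrow> u x = f x"
    using f by (simp_all add: borel_rep_def)
  have inner: "(\<integral>\<^sup>+y. ennreal ((norm (u y - u x))\<^sup>2 * \<omega> (norm (y - x))) \<partial>lebesgue_on \<Omega>)
      = (\<integral>\<^sup>+y. ennreal ((norm (f y - f x))\<^sup>2 * weight (y, x)) \<partial>lborel)"
    if x: "x \<in> \<Omega>" "u x = f x" for x
  proof -
    have "AE y in lborel. y \<in> \<Omega> \<longrightarrow> ennreal ((norm (u y - u x))\<^sup>2 * \<omega> (norm (y - x)))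
        = ennreal ((norm (f y - f x))\<^sup>2 * weight (y, x))"
      using ae w_eq_left[of x] by eventually_elim (use x in \<open>simp add: weight_def\<close>)
    then show ?thesis
      by (intro nn_integral_lebesgue_on_eq_lborel) (auto simp: weight_off)
  qed
  have "AE x in lborel. x \<in> \<Omega> \<longrightarrow> (\<integral>\<^sup>+y. ennreal ((norm (u y - u x))\<^sup>2 * \<omega> (norm (y - x))) \<partial>lebesgue_on \<Omega>)
      = (\<integral>\<^sup>+y. ennreal ((norm (f y - f x))\<^sup>2 * weight (y, x)) \<partial>lborel)"
    using ae by eventually_elim (use inner in blast)
  then have "(\<integral>\<^sup>+x. (\<integral>\<^sup>+y. ennreal ((norm (u y - u x))\<^sup>2 * \<omega> (norm (y - x))) \<partial>lebesgue_on \<Omega>) \<partial>lebesgue_on \<Omega>)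
    = (\<integral>\<^sup>+x. \<integral>\<^sup>+y. ennreal ((norm (f y - f x))\<^sup>2 * weight (y, x)) \<partial>lborel \<partial>lborel)"
    by (intro nn_integral_lebesgue_on_eq_lborel) (auto simp: weight_off)
  then show ?thesis using u by (simp add: V_space_def)
qed

text \<open>The square of a difference is at most twice the sum of the squares, so the nonlocal energy of a
  difference quotient is finite. The passage to Borel versions is needed for the additivity of the iterated
  nonnegative integral.\<close>

lemma V_space_diff_quot:
  fixes u v :: "real^'n \<Rightarrow> real^'n"
  assumes u: "u \<in> V_space \<Omega> \<omega>" and v: "v \<in> V_space \<Omega> \<omega>"
  shows "diff_quot c u v \<in> V_space \<Omega> \<omega>"
proof -
  have L2: "u \<in> L2 \<Omega>" "v \<in> L2 \<Omega>" using assms by (simp_all add: V_space_def)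
  obtain f where f: "borel_rep \<Omega> u f" by (rule borel_rep_exists[of \<Omega> u]) (use L2 in \<open>auto simp: L2_def\<close>)
  obtain g where g: "borel_rep \<Omega> v g" by (rule borel_rep_exists[of \<Omega> v]) (use L2 in \<open>auto simp: L2_def\<close>)
  have [measurable]: "f \<in> borel_measurable borel" "g \<in> borel_measurable borel"
    using f g by (simp_all add: borel_rep_def)
  let ?E = "\<lambda>h x y. (norm (h y - h x :: real^'n))\<^sup>2 * weight (y, x)"
  have le: "?E (diff_quot c f g) x y \<le> 2 * (1/c)\<^sup>2 * (?E f x y + ?E g x y)" for x y
  proof -
    have "diff_quot c f g y - diff_quot c f g x = (1/c) *\<^sub>R ((f y - f x) - (g y - g x))"
      by (simp add: diff_quot_def scaleR_diff_right algebra_simps)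
    then have "(norm (diff_quot c f g y - diff_quot c f g x))\<^sup>2
        \<le> 2 * (1/c)\<^sup>2 * ((norm (f y - f x))\<^sup>2 + (norm (g y - g x))\<^sup>2)"
      using norm_scaled_diff_square_le[of "1/c" "f y - f x" "g y - g x"] by simp
    from mult_right_mono[OF this weight_nonneg[of "(y, x)"]]
    show ?thesis by (simp add: algebra_simps)
  qed
  have "(\<integral>\<^sup>+x. \<integral>\<^sup>+y. ennreal (?E (diff_quot c f g) x y) \<partial>lborel \<partial>lborel)
    \<le> (\<integral>\<^sup>+x. \<integral>\<^sup>+y. ennreal (2 * (1/c)\<^sup>2) * (ennreal (?E f x y) + ennreal (?E g x y)) \<partial>lborel \<partial>lborel)"
  proof (rule nn_integral_mono, rule nn_integral_mono)
    fix x y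
    have nn: "0 \<le> ?E f x y" "0 \<le> ?E g x y" by (simp_all add: weight_nonneg)
    have "ennreal (?E (diff_quot c f g) x y) \<le> ennreal (2 * (1/c)\<^sup>2 * (?E f x y + ?E g x y))"
      by (rule ennreal_leI[OF le])
    also have "\<dots> = ennreal (2 * (1/c)\<^sup>2) * (ennreal (?E f x y) + ennreal (?E g x y))"
      using nn by (subst ennreal_mult) (simp_all only: ennreal_plus add_nonneg_nonneg, simp)
    finally show "ennreal (?E (diff_quot c f g) x y) \<le> ennreal (2 * (1/c)\<^sup>2) * (ennreal (?E f x y) + ennreal (?E g x y))" .
  qed
  also have "\<dots> = ennreal (2 * (1/c)\<^sup>2) * ((\<integral>\<^sup>+x. \<integral>\<^sup>+y. ennreal (?E f x y) \<partial>lborel \<partial>lborel)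
      + (\<integral>\<^sup>+x. \<integral>\<^sup>+y. ennreal (?E g x y) \<partial>lborel \<partial>lborel))"
    by (simp add: nn_integral_cmult nn_integral_add)
  also have "\<dots> < \<infinity>"
    using V_space_iff_rep[OF f L2(1)] V_space_iff_rep[OF g L2(2)] assms
    by (auto simp: ennreal_mult_less_top)
  finally show ?thesis
    using V_space_iff_rep[OF borel_rep_diff_quot[OF f g] L2_diff_quot[OF _ L2]] by simp
qed

lemma V_space_bc_diff_quot:
  assumes "u \<in> V_space_bc \<Omega> \<omega> \<Gamma> h" "v \<in> V_space_bc \<Omega> \<omega> \<Gamma> h"
  shows "diff_quot c u v \<in> V_space_bc \<Omega> \<omega> \<Gamma> (\<lambda>_. 0)"
proof -
  have "AE x in lebesgue_on \<Gamma>. u x = h x" "AE x in lebesgue_on \<Gamma>. v x = h x"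
    using assms by (simp_all add: V_space_bc_def)
  then have "AE x in lebesgue_on \<Gamma>. diff_quot c u v x = 0"
    by eventually_elim (simp add: diff_quot_def)
  then show ?thesis using assms V_space_diff_quot by (simp add: V_space_bc_def)
qed

end

lemma crack_functional_eq_form: "crack_functional \<Omega> \<delta> \<omega> \<psi> = crack_form \<Omega> \<delta> \<omega> \<psi> \<psi> / 2"
  by (simp add: crack_functional_def crack_form_def power2_eq_square mult.assoc add_divide_distrib)

lemma crack_form_nonneg:
  assumes "\<And>s. 0 \<le> s \<Longrightarrow> 0 \<le> \<omega> s" "0 < \<delta>"
  shows "0 \<le> crack_form \<Omega> \<delta> \<omega> \<psi> \<psi>"
proof -
  have "0 \<le> (LINT x|lebesgue_on \<Omega>. \<psi> x * \<psi> x)"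
    by (intro integral_nonneg_AE AE_I2) simp
  moreover have "0 \<le> (LINT y|lebesgue_on \<Omega>. LINT x|lebesgue_on \<Omega>.
       \<omega> (norm (y - x)) * (\<psi> x - \<psi> y) * (\<psi> x - \<psi> y))"
    by (intro integral_nonneg_AE AE_I2) (simp add: assms(1) mult.assoc)
  ultimately show ?thesis
    unfolding crack_form_def using assms(2) by simp
qed

lemma l2_norm_square: "(l2_norm S f)\<^sup>2 = (LINT x|lebesgue_on S. (norm (f x))\<^sup>2)"
  unfolding l2_norm_def by (rule real_sqrt_pow2) simp

lemma L2_subset_integrable:
  assumes f: "f \<in> L2 \<Omega>" and S: "S \<subseteq> \<Omega>" "S \<in> sets lebesgue" "\<Omega> \<in> sets lebesgue"
  shows "integrable (lebesgue_on S) (\<lambda>x. (norm (f x))\<^sup>2)"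
proof -
  have "integrable lebesgue (\<lambda>x. indicator \<Omega> x *\<^sub>R (norm (f x))\<^sup>2)"
    using f S by (simp add: L2_def integrable_restrict_space)
  then have "integrable lebesgue (\<lambda>x. indicator S x *\<^sub>R (indicator \<Omega> x *\<^sub>R (norm (f x))\<^sup>2))"
    using S(2) by (rule integrable_mult_indicator[rotated])
  moreover have "(\<lambda>x. indicator S x *\<^sub>R (indicator \<Omega> x *\<^sub>R (norm (f x))\<^sup>2)) = (\<lambda>x. indicator S x *\<^sub>R (norm (f x))\<^sup>2)"
    using S by (auto simp: indicator_def fun_eq_iff)
  ultimately have "integrable lebesgue (\<lambda>x. indicator S x *\<^sub>R (norm (f x))\<^sup>2)"
    by (simp only:)
  then show ?thesis using S by (subst integrable_restrict_space) simp_all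
qed

text \<open>The test field \<open>w\<close> and the velocity \<open>v'\<close> agree only almost everywhere, as the scheme equates fields
  of \<open>L\<^sup>2\<close>.\<close>

lemma kinetic_polarization:
  fixes v v' w :: "real^'n \<Rightarrow> 'b::euclidean_space"
  assumes \<Omega>: "\<Omega> \<in> sets borel" and S: "S \<subseteq> \<Omega>" "S \<in> sets lebesgue"
    and v: "v \<in> L2 \<Omega>" "v' \<in> L2 \<Omega>" "w \<in> L2 \<Omega>" and w: "AE x in lebesgue_on \<Omega>. w x = v' x"
  shows "l2_inner S (diff_quot c v' v) w
    = 1 / (2 * c) * ((l2_norm S v')\<^sup>2 - (l2_norm S v)\<^sup>2 + (l2_norm S (\<lambda>x. v' x - v x))\<^sup>2)"
proof -
  have \<Omega>l: "\<Omega> \<in> sets lebesgue" using \<Omega> by simp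
  have dL: "(\<lambda>x. v' x - v x) \<in> L2 \<Omega>"
    using L2_diff_quot[OF \<Omega> v(2,1), of 1] by (simp add: diff_quot_1)
  have meas: "f \<in> borel_measurable (lebesgue_on S)" if "f \<in> L2 \<Omega>" for f :: "real^'n \<Rightarrow> 'b"
    using that S by (auto simp: L2_def intro: measurable_restrict_mono)
  have int: "integrable (lebesgue_on S) (\<lambda>x. (norm (f x))\<^sup>2)" if "f \<in> L2 \<Omega>" for f :: "real^'n \<Rightarrow> 'b"
    by (rule L2_subset_integrable[OF that S \<Omega>l])
  have "AE x in lebesgue_on S. w x = v' x"
    using w S \<Omega>l by (auto simp: AE_restrict_space_iff elim!: eventually_mono)
  then have "AE x in lebesgue_on S. diff_quot c v' v x \<bullet> w x
      = 1 / (2 * c) * ((norm (v' x))\<^sup>2 - (norm (v x))\<^sup>2 + (norm (v' x - v x))\<^sup>2)"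
  proof eventually_elim
    case (elim x)
    then show ?case
    proof -
      have "(norm a)\<^sup>2 - (norm b)\<^sup>2 + (norm (a - b))\<^sup>2 = 2 * ((a - b) \<bullet> a)" for a b :: 'b
        by (simp add: power2_norm_eq_inner inner_diff_left inner_diff_right inner_commute)
      then show ?thesis using elim by (simp add: diff_quot_def)
    qed
  qed
  moreover note [measurable] = meas[OF v(1)] meas[OF v(2)] meas[OF v(3)] meas[OF L2_diff_quot[OF \<Omega> v(2,1)]]
  ultimately have "l2_inner S (diff_quot c v' v) w
      = (LINT x|lebesgue_on S. 1 / (2 * c) * ((norm (v' x))\<^sup>2 - (norm (v x))\<^sup>2 + (norm (v' x - v x))\<^sup>2))"
    unfolding l2_inner_def
    by (intro integral_cong_AE) measurable
  also have "\<dots> = 1 / (2 * c) * ((LINT x|lebesgue_on S. (norm (v' x))\<^sup>2) - (LINT x|lebesgue_on S. (norm (v x))\<^sup>2)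
      + (LINT x|lebesgue_on S. (norm (v' x - v x))\<^sup>2))"
    using int[OF v(1)] int[OF v(2)] int[OF dL] by simp
  finally show ?thesis by (simp add: l2_norm_square)
qed

section \<open>Energy dissipation of the scheme\<close>

theorem theorem3p1:
  fixes \<Omega> \<Gamma>t \<Gamma>u \<Omega>in :: "(real^'n) set"
    and \<delta> lam \<mu> \<rho> Gc etabar \<eta> dt C0 Ak \<xi> :: real
    and \<omega> :: "real \<Rightarrow> real"
    and b t ug :: "real^'n \<Rightarrow> real^'n"
    and u u' v v' :: "real^'n \<Rightarrow> real^'n"
    and \<psi> \<psi>' :: "real^'n \<Rightarrow> real"
    and r r' :: real
    and Fu :: "(real^'n \<Rightarrow> real^'n) \<Rightarrow> real"
    and Fpsi :: "(real^'n \<Rightarrow> real) \<Rightarrow> real"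
  assumes dim: "CARD('n) = 2 \<or> CARD('n) = 3"
    and domain: "bounded_lipschitz_domain \<Omega>"
    and delta: "\<delta> > 0"
    and layer: "\<Gamma>t \<union> \<Gamma>u = boundary_layer \<Omega> \<delta>" "\<Gamma>t \<noteq> {}" "\<Gamma>u \<noteq> {}"
      "interior \<Gamma>t \<inter> interior \<Gamma>u = {}" "\<Gamma>t \<in> sets lebesgue" "\<Gamma>u \<in> sets lebesgue"
    and kernel: "admissible_kernel TYPE('n) \<delta> \<omega>"
    and constants: "\<rho> > 0" "Gc > 0" "etabar \<ge> 0" "dt > 0" "C0 > 0"
    and data: "b \<in> L2 \<Omega>" "t \<in> L2 \<Gamma>t"
    \<comment> \<open>abbreviations\<close>
    and inner_def: "\<Omega>in = \<Omega> - boundary_layer \<Omega> \<delta>"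
    and eta_def: "\<eta> = etabar * Gc / \<delta>"
    and Ak_def: "Ak = shifted_energy \<Omega> \<delta> \<omega> lam \<mu> \<Gamma>t b t C0 u \<psi>"
    and Fu_def: "\<And>w. Fu w = F_u \<Omega> \<delta> \<omega> lam \<mu> \<Gamma>t b t u \<psi> w"
    and Fpsi_def: "\<And>\<phi>. Fpsi \<phi> = F_psi \<Omega> \<delta> \<omega> lam \<mu> u \<psi> \<phi>"
    and xi_def: "\<xi> = r' / sqrt Ak"
    \<comment> \<open>state at level k\<close>
    and old: "u \<in> V_space_bc \<Omega> \<omega> \<Gamma>u ug" "v \<in> L2 \<Omega>" "\<psi> \<in> M_space \<Omega> \<delta> \<omega>"
    \<comment> \<open>finiteness of the energy and of the pairings\<close>
    and fin_A: "integrable (lebesgue_on \<Omega>) (W_de \<Omega> \<delta> \<omega> lam \<mu> u \<psi>)"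
    and fin_Fu: "\<And>w. w \<in> V_space_bc \<Omega> \<omega> \<Gamma>u (\<lambda>_. 0) \<Longrightarrow>
      integrable (lebesgue_on \<Omega>) (\<lambda>x. stress_d \<Omega> \<delta> \<omega> lam \<mu> u \<psi> x \<bullet> nl_strain \<Omega> \<delta> \<omega> w x)"
    and fin_Fpsi: "\<And>\<phi>. \<phi> \<in> M_space \<Omega> \<delta> \<omega> \<Longrightarrow>
      integrable (lebesgue_on \<Omega>) (F_psi_density \<Omega> \<delta> \<omega> lam \<mu> u \<psi> \<phi>)"
    and Ak_pos: "Ak > 0"
    \<comment> \<open>solution of the scheme at level k+1, before the projection\<close>
    and new: "u' \<in> V_space_bc \<Omega> \<omega> \<Gamma>u ug" "v' \<in> L2 \<Omega>" "\<psi>' \<in> M_space \<Omega> \<delta> \<omega>"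
    and step_u: "AE x in lebesgue_on \<Omega>. u' x = u x + dt *\<^sub>R v' x"
    and step_v: "\<And>w. w \<in> V_space_bc \<Omega> \<omega> \<Gamma>u (\<lambda>_. 0) \<Longrightarrow>
      \<rho> * l2_inner \<Omega>in (diff_quot dt v' v) w + \<xi> * Fu w = 0"
    and step_psi: "\<And>\<phi>. \<phi> \<in> M_space \<Omega> \<delta> \<omega> \<Longrightarrow>
      \<eta> * l2_inner \<Omega> (diff_quot dt \<psi>' \<psi>) \<phi> + Gc * crack_form \<Omega> \<delta> \<omega> \<psi>' \<phi> + \<xi> * Fpsi \<phi> = 0"
    and step_r: "(r' - r) / dt =
      1 / (2 * sqrt Ak) * (Fu (diff_quot dt u' u) + Fpsi (diff_quot dt \<psi>' \<psi>))"
  shows "mod_hamiltonian \<Omega> \<delta> \<omega> \<rho> Gc C0 v' \<psi>' r' - mod_hamiltonian \<Omega> \<delta> \<omega> \<rho> Gc C0 v \<psi> r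
      + \<rho> / 2 * (l2_norm \<Omega>in (\<lambda>x. v' x - v x))\<^sup>2
      + Gc / 2 * crack_form \<Omega> \<delta> \<omega> (\<lambda>x. \<psi>' x - \<psi> x) (\<lambda>x. \<psi>' x - \<psi> x)
      + (r' - r)\<^sup>2
      + dt * \<eta> * (l2_norm \<Omega> (diff_quot dt \<psi>' \<psi>))\<^sup>2 = 0
    \<and> mod_hamiltonian \<Omega> \<delta> \<omega> \<rho> Gc C0 v' \<psi>' r' \<le> mod_hamiltonian \<Omega> \<delta> \<omega> \<rho> Gc C0 v \<psi> r"
proof -
  have \<Omega>: "open \<Omega>" "bounded \<Omega>"
    using domain by (simp_all add: bounded_lipschitz_domain_def)
  have \<omega>0: "\<And>s. 0 \<le> s \<Longrightarrow> 0 \<le> \<omega> s"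
    using kernel by (simp add: admissible_kernel_def)
  obtain w where "kernel_representative \<Omega> \<delta> \<omega> w"
    using kernel_representative_exists[OF kernel delta \<Omega>] .
  then interpret kernel_representative \<Omega> \<delta> \<omega> w .
  let ?Du = "diff_quot dt u' u" and ?D\<psi> = "diff_quot dt \<psi>' \<psi>"
  let ?a = "crack_form \<Omega> \<delta> \<omega>" and ?d\<psi> = "\<lambda>x. \<psi>' x - \<psi> x"
  let ?E = "(l2_norm \<Omega>in v)\<^sup>2" and ?E' = "(l2_norm \<Omega>in v')\<^sup>2" and ?dE = "(l2_norm \<Omega>in (\<lambda>x. v' x - v x))\<^sup>2"
  let ?N = "(l2_norm \<Omega> ?D\<psi>)\<^sup>2"
  have "boundary_layer \<Omega> \<delta> = \<Omega> \<inter> {x. infdist x (frontier \<Omega>) \<le> \<delta>}"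
    by (auto simp: boundary_layer_def)
  moreover have "closed {x. infdist x (frontier \<Omega>) \<le> \<delta>}"
    by (intro closed_Collect_le continuous_intros)
  ultimately have "boundary_layer \<Omega> \<delta> \<in> sets borel" by simp
  then have in_meas: "\<Omega>in \<in> sets lebesgue" and in_sub: "\<Omega>in \<subseteq> \<Omega>"
    unfolding inner_def by auto
  \<comment> \<open>\<open>u'\<close> and \<open>u\<close> carry the same boundary datum, so their difference quotient may be used as a
    test field; by the first equation of the scheme it is the new velocity.\<close>
  have DuV: "?Du \<in> V_space_bc \<Omega> \<omega> \<Gamma>u (\<lambda>_. 0)"
    by (rule V_space_bc_diff_quot[OF new(1) old(1)])
  then have DuL2: "?Du \<in> L2 \<Omega>" by (simp add: V_space_bc_def V_space_def)
  have Du_eq: "AE x in lebesgue_on \<Omega>. ?Du x = v' x"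
    using step_u by eventually_elim (use constants(4) in \<open>simp add: diff_quot_def\<close>)
  have u_test: "\<rho> * (1 / (2 * dt) * (?E' - ?E + ?dE)) + \<xi> * Fu ?Du = 0"
    using step_v[OF DuV] kinetic_polarization[OF domain_borel in_sub in_meas old(2) new(2) DuL2 Du_eq]
    by simp
  have "l2_inner \<Omega> ?D\<psi> ?D\<psi> = ?N"
    unfolding l2_inner_def l2_norm_square by (simp add: power2_eq_square)
  then have \<psi>_test: "\<eta> * ?N + Gc * (1 / (2 * dt) * (?a \<psi>' \<psi>' - ?a \<psi> \<psi> + ?a ?d\<psi> ?d\<psi>)) + \<xi> * Fpsi ?D\<psi> = 0"
    using step_psi[OF M_space_diff_quot[OF new(3) old(3), of dt]] crack_form_polarization[OF new(3) old(3), of dt]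
    by (simp only:)
  \<comment> \<open>\<open>2 r'\<close> is the multiplier because \<open>2 r' / (2 sqrt Ak) = \<xi>\<close>\<close>
  have "2 * r' * ((r' - r) / dt) = \<xi> * (Fu ?Du + Fpsi ?D\<psi>)"
    unfolding step_r xi_def by simp
  then have r_test: "2 * r' * (r' - r) = dt * (\<xi> * (Fu ?Du + Fpsi ?D\<psi>))"
    using constants(4) by (simp add: field_simps)
  have u_test': "\<rho> / 2 * (?E' - ?E + ?dE) + dt * (\<xi> * Fu ?Du) = 0"
    using arg_cong[OF u_test, of "\<lambda>z. dt * z"] constants(4) by (simp add: distrib_left)
  have \<psi>_test': "dt * \<eta> * ?N + Gc / 2 * (?a \<psi>' \<psi>' - ?a \<psi> \<psi> + ?a ?d\<psi> ?d\<psi>) + dt * (\<xi> * Fpsi ?D\<psi>) = 0"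
    using arg_cong[OF \<psi>_test, of "\<lambda>z. dt * z"] constants(4) by (simp add: distrib_left mult.assoc)
  have r_pol: "2 * r' * (r' - r) = r'\<^sup>2 - r\<^sup>2 + (r' - r)\<^sup>2"
    by (simp add: power2_eq_square algebra_simps)
  have "\<rho> / 2 * (?E' - ?E + ?dE) + Gc / 2 * (?a \<psi>' \<psi>' - ?a \<psi> \<psi> + ?a ?d\<psi> ?d\<psi>)
      + (r'\<^sup>2 - r\<^sup>2 + (r' - r)\<^sup>2) + dt * \<eta> * ?N = 0"
    using u_test' \<psi>_test' r_test r_pol by (simp add: distrib_left)
  then have balance: "mod_hamiltonian \<Omega> \<delta> \<omega> \<rho> Gc C0 v' \<psi>' r' - mod_hamiltonian \<Omega> \<delta> \<omega> \<rho> Gc C0 v \<psi> r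
      + \<rho> / 2 * ?dE + Gc / 2 * ?a ?d\<psi> ?d\<psi> + (r' - r)\<^sup>2 + dt * \<eta> * ?N = 0"
    unfolding mod_hamiltonian_def crack_functional_eq_form inner_def[symmetric]
    by (simp add: algebra_simps)
  have "0 \<le> \<rho> / 2 * ?dE" "0 \<le> (r' - r)\<^sup>2" "0 \<le> dt * \<eta> * ?N"
    using constants delta by (simp_all add: eta_def)
  moreover have "0 \<le> Gc / 2 * ?a ?d\<psi> ?d\<psi>"
    by (intro mult_nonneg_nonneg crack_form_nonneg \<omega>0 delta) (use constants in simp_all)
  ultimately show ?thesis using balance by linarith
qed

end
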